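(* Let $n\ge 2$ and let $\mathbb{F}$ be a field with at least $n$ pairwise different elements, with a fixed total order on its underlying set. The polynomial invariants $$\mathrm{Set}_{\sigma}=\{\sigma_t(X_1)\;|\;1\le t\le n\}$$ together with the abstract invariants $$\mathrm{Set}_{\zeta}=\{\zeta(F)\;|\;F\in \mathrm{alg}_{\mathbb{F}}\{X\}_2 \text{ has degree less than or equal to } 2n-1\}$$ form a set that separates types of elements of $D_n$; that is, if $\underline{A},\underline{B}\in D_n$ and $f(\underline{A})=f(\underline{B})$ for all $f\in \mathrm{Set}_{\sigma}\cup\mathrm{Set}_{\zeta}$, then $\underline{A}$ and $\underline{B}$ have the same type.
   Context: $\mathbb{F}$ is a field (possibly finite, of arbitrary characteristic); the total order on $\mathbb{F}$ is just an order on the set, with no compatibility with the field operations. $M_n$ is the space of $n\times n$ matrices over $\mathbb{F}$, and $\mathrm{GL}_n=\mathrm{GL}_n(\mathbb{F})$ acts on $M_n^2$ by $g\cdot(A_1,A_2)=(gA_1g^{-1},gA_2g^{-1})$. $D_n\subset M_n^2$ is the set of all pairs $\underline{A}=(A_1,A_2)$ such that $A_1$ has $n$ distinct eigenvalues in $\mathbb{F}$; it is $\mathrm{GL}_n$-invariant. Generic matrices. $X_k=(x_{ij}(k))_{1\le i,j\le n}$, $k=1,2$, are the generic $n\times n$ matrices with independent commuting variables as entries, and $\mathrm{alg}_{\mathbb{F}}\{X\}_2$ is the associative $\mathbb{F}$-algebra generated by $X_1,X_2$ and $I_n$. For $F\in \mathrm{alg}_{\mathbb{F}}\{X\}_2$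 and $\underline{A}\in M_n^2$, $F(\underline{A})\in M_n$ is the result of substituting $X_k\mapsto A_k$. The degree of $F$ is the minimal degree of a non-commutative polynomial $f$ in letters $x_1,x_2$ over $\mathbb{F}$ such that $F=f(X_1,X_2)$. $\sigma_t$ denotes the $t$-th coefficient of the characteristic polynomial of an $n\times n$ matrix ($\sigma_1=\mathrm{tr}$, ..., $\sigma_n=\det$), and $\sigma_t(X_1)$ is the function $\underline{A}\mapsto\sigma_t(A_1)$. The function $\zeta:M_n\to\mathbb{F}$ is $\zeta(A)=1$ if $A=0$ and $\zeta(A)=0$ if $A\ne0$; $\zeta(F)$ is the function $\underline{A}\mapsto\zeta(F(\underline{A}))$. Canonical $\ast$-matrices. A $\ast$-matrix is an $n\times n$ array $\mathcal{A}$ with entries $\mathcal{A}_{ij}\in\{0,1,\ast\}$, identified with the set of all $A\in M_n$ such that $A_{ij}=0$ whenever $\mathcal{A}_{ij}=0$ and $A_{ij}=1$ whenever $\mathcal{A}_{ij}=1$. A forest is a directed finite graph with numbered vertices $v_1,\ldots,v_n$ without undirected cycles (in particular, no loops and at most one arrow between two vertices). Order pairs lexicographically: $(i,j)<(r,s)$ if $i<r$, or $i=r$ and $j<s$. A $\ast$-matrix $\mathcal{A}$ is canonical if there is a forest $G=G_{\mathcal{A}}$ on $v_1,\ldots,v_n$ such that $\mathcal{A}_{ii}=\ast$ for all $i$ and for all $i\ne j$: (i) $\mathcal{A}_{ij}=1$ if $G$ has the arrow $v_i\to v_j$; (ii) $\mathcal{A}_{ij}=0$ if either $G$ has no undirected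 path from $v_i$ to $v_j$, or the (unique) undirected path from $v_i$ to $v_j$ contains an arrow $v_r\to v_s$ with $(r,s)>(i,j)$; (iii) $\mathcal{A}_{ij}=\ast$ if there is a (unique) undirected path from $v_i$ to $v_j$ and every arrow $v_r\to v_s$ of it satisfies $(r,s)<(i,j)$. The map $\mathcal{A}\mapsto G_{\mathcal{A}}$ is a bijection between canonical $n\times n$ $\ast$-matrices and forests on $v_1,\ldots,v_n$. Types. A pair $\underline{A}\in D_n$ is canonical if $A_1=\mathrm{diag}(a_1,\ldots,a_n)$ with $a_1<\cdots<a_n$ and $A_2\in\mathcal{A}$ for some canonical $\ast$-matrix $\mathcal{A}$; this $\mathcal{A}$ is unique, and $G_{\mathcal{A}}$ is called the type of $\underline{A}$. It is known (Futorny–Horn–Sergeichuk) that every $\mathrm{GL}_n$-orbit on $D_n$ contains exactly one canonical pair; the type of an arbitrary element of $D_n$ is the type of the canonical pair in its orbit. *)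

theory Defs
  imports
    "Jordan_Normal_Form.Char_Poly"
    "HOL-Library.Poly_Mapping"
begin

text \<open>
  Matrices are those of \<open>Jordan_Normal_Form\<close>, so rows, columns and the vertices
  \<open>v\<^sub>1, \<dots>, v\<^sub>n\<close> are numbered \<open>0, \<dots>, n - 1\<close>; the shift preserves all orders used below.
  The sort \<open>{field, linorder}\<close> is a field with a total order on its underlying set: the class
  \<open>linorder\<close> does not relate the order to the field operations.
\<close>

section \<open>Generic matrices\<close>

datatype letter = L1 | L2

text \<open>Commutative polynomials in the variables \<open>x\<^sub>i\<^sub>j(k)\<close>, indexed by \<open>(k, i, j)\<close>:
  the monoid algebra on the free commutative monoid of monomials.\<close>

type_synonym 'a gpoly = "(letter \<times> nat \<times> nat \<Rightarrow>\<^sub>0 nat) \<Rightarrow>\<^sub>0 'a"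

definition gvar :: "letter \<times> nat \<times> nat \<Rightarrow> 'a::comm_ring_1 gpoly" where
  "gvar v = Poly_Mapping.single (Poly_Mapping.single v 1) 1"

definition gconst :: "'a::comm_ring_1 \<Rightarrow> 'a gpoly" where
  "gconst c = Poly_Mapping.single 0 c"

definition gpoly_eval :: "(letter \<times> nat \<times> nat \<Rightarrow> 'a::comm_ring_1) \<Rightarrow> 'a gpoly \<Rightarrow> 'a" where
  "gpoly_eval \<rho> p = (\<Sum>m\<in>Poly_Mapping.keys p. Poly_Mapping.lookup p m *
     (\<Prod>v\<in>Poly_Mapping.keys m. \<rho> v ^ Poly_Mapping.lookup m v))"

definition generic_mat :: "nat \<Rightarrow> letter \<Rightarrow> 'a::comm_ring_1 gpoly mat" where
  "generic_mat n k = mat n n (\<lambda>(i, j). gvar (k, i, j))"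

text \<open>The algebra generated by the generic matrices and the identity.\<close>

inductive_set generic_alg :: "nat \<Rightarrow> 'a::comm_ring_1 gpoly mat set" for n :: nat where
  gen: "generic_mat n k \<in> generic_alg n"
| one: "1\<^sub>m n \<in> generic_alg n"
| add: "F \<in> generic_alg n \<Longrightarrow> G \<in> generic_alg n \<Longrightarrow> F + G \<in> generic_alg n"
| mult: "F \<in> generic_alg n \<Longrightarrow> G \<in> generic_alg n \<Longrightarrow> F * G \<in> generic_alg n"
| smult: "F \<in> generic_alg n \<Longrightarrow> gconst c \<cdot>\<^sub>m F \<in> generic_alg n"

fun component :: "'a mat \<times> 'a mat \<Rightarrow> letter \<Rightarrow> 'a mat" where
  "component A L1 = fst A"
| "component A L2 = snd A"

definition subst_pair :: "'a::comm_ring_1 gpoly mat \<Rightarrow> 'a mat \<times> 'a mat \<Rightarrow> 'a mat" where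
  "subst_pair F A = map_mat (gpoly_eval (\<lambda>(k, i, j). component A k $$ (i, j))) F"

text \<open>Non-commutative polynomials are finitely supported coefficient functions on words.
  The zero polynomial gets degree \<open>0\<close>.\<close>

type_synonym 'a ncpoly = "letter list \<Rightarrow>\<^sub>0 'a"

definition nc_degree :: "'a::zero ncpoly \<Rightarrow> nat" where
  "nc_degree f = Max (insert 0 (length ` Poly_Mapping.keys f))"

fun generic_word :: "nat \<Rightarrow> letter list \<Rightarrow> 'a::comm_ring_1 gpoly mat" where
  "generic_word n [] = 1\<^sub>m n"
| "generic_word n (k # w) = generic_mat n k * generic_word n w"

text \<open>\<open>f(X\<^sub>1, X\<^sub>2)\<close>; the sum of matrices is written entrywise.\<close>

definition nc_at_generic :: "nat \<Rightarrow> 'a::comm_ring_1 ncpoly \<Rightarrow> 'a gpoly mat" where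
  "nc_at_generic n f = mat n n (\<lambda>(i, j). \<Sum>w\<in>Poly_Mapping.keys f.
     gconst (Poly_Mapping.lookup f w) * generic_word n w $$ (i, j))"

definition generic_degree :: "nat \<Rightarrow> 'a::comm_ring_1 gpoly mat \<Rightarrow> nat" where
  "generic_degree n F = (LEAST d. \<exists>f. F = nc_at_generic n f \<and> nc_degree f = d)"

section \<open>Invariants\<close>

text \<open>Normalised by \<open>det (x I - A) = (\<Sum>t\<le>n. (- 1) ^ t * \<sigma>\<^sub>t(A) * x ^ (n - t))\<close>, so that
  \<open>\<sigma>\<^sub>1\<close> is the trace and \<open>\<sigma>\<^sub>n\<close> the determinant.\<close>

definition sigma :: "nat \<Rightarrow> nat \<Rightarrow> 'a::comm_ring_1 mat \<Rightarrow> 'a" where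
  "sigma n t A = (- 1) ^ t * coeff (char_poly A) (n - t)"

definition zeta :: "nat \<Rightarrow> 'a::comm_ring_1 mat \<Rightarrow> 'a" where
  "zeta n A = (if A = 0\<^sub>m n n then 1 else 0)"

definition Set_sigma :: "nat \<Rightarrow> ('a::comm_ring_1 mat \<times> 'a mat \<Rightarrow> 'a) set" where
  "Set_sigma n = {\<lambda>A. sigma n t (fst A) | t. 1 \<le> t \<and> t \<le> n}"

definition Set_zeta :: "nat \<Rightarrow> ('a::comm_ring_1 mat \<times> 'a mat \<Rightarrow> 'a) set" where
  "Set_zeta n = {\<lambda>A. zeta n (subst_pair F A) | F.
     F \<in> generic_alg n \<and> generic_degree n F \<le> 2 * n - 1}"

section \<open>Pairs of matrices\<close>

definition D :: "nat \<Rightarrow> ('a::field mat \<times> 'a mat) set" where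
  "D n = {(A1, A2). A1 \<in> carrier_mat n n \<and> A2 \<in> carrier_mat n n \<and>
     finite {k. eigenvalue A1 k} \<and> card {k. eigenvalue A1 k} = n}"

text \<open>The \<open>GL\<^sub>n\<close>-orbit; \<open>h\<close> is the inverse of \<open>g\<close>.\<close>

definition orbit :: "nat \<Rightarrow> 'a::field mat \<times> 'a mat \<Rightarrow> ('a mat \<times> 'a mat) set" where
  "orbit n A = {(g * fst A * h, g * snd A * h) | g h.
     g \<in> carrier_mat n n \<and> h \<in> carrier_mat n n \<and> g * h = 1\<^sub>m n \<and> h * g = 1\<^sub>m n}"

section \<open>Forests\<close>

text \<open>A directed graph on the vertices \<open>0, \<dots>, n - 1\<close> is its set of arrows. Undirected walks are
  lists of arrows, each of which may be traversed in either direction.\<close>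

definition across :: "nat \<Rightarrow> nat \<times> nat \<Rightarrow> nat" where
  "across u e = (if fst e = u then snd e else fst e)"

fun uwalk :: "(nat \<times> nat) set \<Rightarrow> nat \<Rightarrow> (nat \<times> nat) list \<Rightarrow> nat \<Rightarrow> bool" where
  "uwalk G u [] v \<longleftrightarrow> u = v"
| "uwalk G u (e # es) v \<longleftrightarrow> e \<in> G \<and> u \<in> {fst e, snd e} \<and> uwalk G (across u e) es v"

fun uverts :: "nat \<Rightarrow> (nat \<times> nat) list \<Rightarrow> nat list" where
  "uverts u [] = [u]"
| "uverts u (e # es) = u # uverts (across u e) es"

definition upath :: "(nat \<times> nat) set \<Rightarrow> nat \<Rightarrow> (nat \<times> nat) list \<Rightarrow> nat \<Rightarrow> bool" where
  "upath G u es v \<longleftrightarrow> uwalk G u es v \<and> distinct (uverts u es)"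

text \<open>No arrow is repeated in a cycle, so going back and forth along one arrow is not a cycle,
  whereas a loop and a pair of opposite arrows are cycles of length 1 and 2.\<close>

definition ucycle :: "(nat \<times> nat) set \<Rightarrow> nat \<Rightarrow> (nat \<times> nat) list \<Rightarrow> bool" where
  "ucycle G u es \<longleftrightarrow>
     es \<noteq> [] \<and> uwalk G u es u \<and> distinct es \<and> distinct (tl (uverts u es))"

definition forest :: "nat \<Rightarrow> (nat \<times> nat) set \<Rightarrow> bool" where
  "forest n G \<longleftrightarrow> G \<subseteq> {..<n} \<times> {..<n} \<and> (\<nexists>u es. ucycle G u es)"

section \<open>Canonical star matrices\<close>

datatype star_entry = Zero | One | Star

definition star_set :: "nat \<Rightarrow> star_entry mat \<Rightarrow> 'a::zero_neq_one mat set" where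
  "star_set n S = {A \<in> carrier_mat n n. \<forall>i<n. \<forall>j<n.
     (S $$ (i, j) = Zero \<longrightarrow> A $$ (i, j) = 0) \<and> (S $$ (i, j) = One \<longrightarrow> A $$ (i, j) = 1)}"

definition lex_less :: "nat \<times> nat \<Rightarrow> nat \<times> nat \<Rightarrow> bool" where
  "lex_less p q \<longleftrightarrow> fst p < fst q \<or> fst p = fst q \<and> snd p < snd q"

definition star_mat_of_forest :: "nat \<Rightarrow> (nat \<times> nat) set \<Rightarrow> star_entry mat \<Rightarrow> bool" where
  "star_mat_of_forest n G S \<longleftrightarrow> forest n G \<and> S \<in> carrier_mat n n \<and>
     (\<forall>i<n. S $$ (i, i) = Star) \<and>
     (\<forall>i<n. \<forall>j<n. i \<noteq> j \<longrightarrow>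
       ((i, j) \<in> G \<longrightarrow> S $$ (i, j) = One) \<and>
       ((\<nexists>es. upath G i es j) \<or> (\<exists>es. upath G i es j \<and> (\<exists>a\<in>set es. lex_less (i, j) a))
          \<longrightarrow> S $$ (i, j) = Zero) \<and>
       ((\<exists>es. upath G i es j \<and> (\<forall>a\<in>set es. lex_less a (i, j))) \<longrightarrow> S $$ (i, j) = Star))"

definition canonical_star_mat :: "nat \<Rightarrow> star_entry mat \<Rightarrow> bool" where
  "canonical_star_mat n S \<longleftrightarrow> (\<exists>G. star_mat_of_forest n G S)"

definition graph_of :: "nat \<Rightarrow> star_entry mat \<Rightarrow> (nat \<times> nat) set" where
  "graph_of n S = (THE G. star_mat_of_forest n G S)"

section \<open>Types\<close>

definition canonical_pair :: "nat \<Rightarrow> 'a::{field, linorder} mat \<times> 'a mat \<Rightarrow> bool" where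
  "canonical_pair n C \<longleftrightarrow> C \<in> D n \<and>
     (\<exists>a. fst C = mat_diag n a \<and> (\<forall>i j. i < j \<and> j < n \<longrightarrow> a i < a j)) \<and>
     (\<exists>S. canonical_star_mat n S \<and> snd C \<in> star_set n S)"

definition type_of_canonical :: "nat \<Rightarrow> 'a::{field, linorder} mat \<times> 'a mat \<Rightarrow> (nat \<times> nat) set"
  where "type_of_canonical n C = graph_of n (THE S. canonical_star_mat n S \<and> snd C \<in> star_set n S)"

text \<open>The descriptions below and above are definite: \<open>S\<close> is unique for a canonical pair, and
  every orbit on \<open>D n\<close> contains exactly one canonical pair (Futorny, Horn, Sergeichuk).\<close>

definition type_of :: "nat \<Rightarrow> 'a::{field, linorder} mat \<times> 'a mat \<Rightarrow> (nat \<times> nat) set" where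
  "type_of n A = type_of_canonical n (THE C. C \<in> orbit n A \<and> canonical_pair n C)"

end

theory Submission
  imports Defs
begin

text \<open>
  A canonical pair with first entry \<open>diag(a\<^sub>1, \<dots>, a\<^sub>n)\<close> has as its type the minimal spanning forest,
  with respect to the lexicographic order on arrows, of the graph of nonzero off-diagonal entries of
  its second matrix: a canonical star matrix allows a nonzero entry off the forest only where
  smaller arrows already join the two vertices, which is the greedy rule of Kruskal's algorithm.
  Pairs in one orbit whose first matrices are diagonal with increasing entries differ by
  conjugation with a diagonal matrix, which preserves the zero pattern. Hence the type of an
  element of \<open>D n\<close> can be read off the zero pattern of any diagonalised representative, and normalising
  the entries on the forest to 1 yields the unique canonical pair of the orbit. Finally, the
  \<open>\<sigma>\<^sub>t\<close> determine the eigenvalues, and with \<open>e\<^sub>i(x) = \<Prod>\<^sub>k\<^sub>\<noteq>\<^sub>i (x - a\<^sub>k)\<close> the element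
  \<open>e\<^sub>i(X\<^sub>1) X\<^sub>2 e\<^sub>j(X\<^sub>1)\<close>, of degree at most \<open>2n - 1\<close>, vanishes on the pair if and only if the
  \<open>(i, j)\<close> entry of the second matrix does.
\<close>

section \<open>Lexicographically minimal spanning forests\<close>

lemma lex_less_iff: "lex_less p q \<longleftrightarrow> (p, q) \<in> less_than <*lex*> less_than"
  by (cases p; cases q) (simp add: lex_less_def)

lemma lex_less_trans: "lex_less p q \<Longrightarrow> lex_less q r \<Longrightarrow> lex_less p r"
  by (auto simp: lex_less_def)

lemma lex_less_linear: "lex_less p q \<or> p = q \<or> lex_less q p"
  by (cases p; cases q) (auto simp: lex_less_def)

text \<open>A lexicographic product of well-founded orders is well-founded. The induction takes
  arrows in the order in which Kruskal's algorithm examines them.\<close>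

lemma lex_less_induct [case_names less]:
  assumes "\<And>p. (\<And>q. lex_less q p \<Longrightarrow> P q) \<Longrightarrow> P p"
  shows "P p"
  using wf_induct_rule[OF wf_lex_prod[OF wf_less_than wf_less_than], of P p] assms
  unfolding lex_less_iff by blast

lemma ex_lex_greatest:
  "es \<noteq> [] \<Longrightarrow> \<exists>m\<in>set es. \<forall>e\<in>set es. e = m \<or> lex_less e m"
proof (induction es rule: list_nonempty_induct)
  case (cons e es)
  then obtain m where m: "m \<in> set es" "\<forall>e\<in>set es. e = m \<or> lex_less e m" by blast
  show ?case
  proof (cases "lex_less e m \<or> e = m")
    case True
    then show ?thesis using m by auto
  next
    case False
    then have "lex_less m e" using lex_less_linear by blast
    then have "d = e \<or> lex_less d e" if "d \<in> set (e # es)" for d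
      using that m(2) lex_less_trans[of d m e] by auto
    then show ?thesis by (intro bexI[of _ e]) auto
  qed
qed simp

text \<open>This is the equivalence relation of lying in the same connected component, so
  connectivity can be handled without manipulating paths.\<close>

definition reach :: "(nat \<times> nat) set \<Rightarrow> (nat \<times> nat) set" where
  "reach H = (H \<union> H\<inverse>)\<^sup>*"

lemma reach_refl [simp]: "(u, u) \<in> reach H"
  by (simp add: reach_def)

lemma reach_trans: "(u, v) \<in> reach H \<Longrightarrow> (v, w) \<in> reach H \<Longrightarrow> (u, w) \<in> reach H"
  unfolding reach_def by (rule rtrancl_trans)

lemma reach_sym: "(u, v) \<in> reach H \<Longrightarrow> (v, u) \<in> reach H"
  unfolding reach_def using sym_rtrancl[OF sym_Un_converse] by (meson symD)

lemma reach_edge: "e \<in> H \<Longrightarrow> e \<in> reach H"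
  unfolding reach_def by auto

text \<open>Since \<open>reach K\<close> is an equivalence relation, it is enough to join the ends
  of each single arrow of \<open>H\<close>.\<close>

lemma reach_least: "H \<subseteq> reach K \<Longrightarrow> reach H \<subseteq> reach K"
proof
  fix p assume H: "H \<subseteq> reach K" and "p \<in> reach H"
  then obtain u v where p: "p = (u, v)" and "(u, v) \<in> (H \<union> H\<inverse>)\<^sup>*"
    by (cases p) (auto simp: reach_def)
  from this(2) have "(u, v) \<in> reach K"
  proof (induction rule: rtrancl_induct)
    case (step y z)
    then have "(y, z) \<in> reach K" using H reach_sym by blast
    then show ?case using step reach_trans by blast
  qed simp
  then show "p \<in> reach K" by (simp add: p)
qed

lemma reach_mono: "H \<subseteq> K \<Longrightarrow> reach H \<subseteq> reach K"
  using reach_edge by (intro reach_least) blast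

section \<open>Walks and paths as witnesses of connectivity\<close>

lemma uwalk_append:
  "uwalk G u (xs @ ys) v \<longleftrightarrow> (\<exists>w. uwalk G u xs w \<and> uwalk G w ys v)"
  by (induction xs arbitrary: u) auto

lemma uwalk_subset: "uwalk G u es v \<Longrightarrow> set es \<subseteq> G"
  by (induction es arbitrary: u) auto

lemma uwalk_mono: "uwalk G u es v \<Longrightarrow> set es \<subseteq> H \<Longrightarrow> uwalk H u es v"
  by (induction es arbitrary: u) auto

lemma reach_across: "e \<in> H \<Longrightarrow> u \<in> {fst e, snd e} \<Longrightarrow> (u, across u e) \<in> reach H"
  using reach_edge[of e H] reach_sym by (cases e) (auto simp: across_def)

lemma uwalk_reach: "uwalk G u es v \<Longrightarrow> set es \<subseteq> H \<Longrightarrow> (u, v) \<in> reach H"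
proof (induction es arbitrary: u)
  case (Cons e es)
  then show ?case using reach_across[of e H u] reach_trans by fastforce
qed simp

lemma uwalk_uverts:
  "uwalk G u es v \<Longrightarrow> e \<in> set es \<Longrightarrow> fst e \<in> set (uverts u es) \<and> snd e \<in> set (uverts u es)"
proof (induction es arbitrary: u)
  case (Cons d es)
  have "across u d \<in> set (uverts (across u d) es)" by (cases es) auto
  then show ?case using Cons by (auto simp: across_def split: if_splits)
qed simp

text \<open>If the first arrow occurred again, the walk would return to its starting vertex, which
  is an end of that arrow.\<close>

lemma upath_distinct: "upath G u es v \<Longrightarrow> distinct es"
proof (induction es arbitrary: u)
  case (Cons e es)
  then have "upath G (across u e) es v" "u \<notin> set (uverts (across u e) es)" "u \<in> {fst e, snd e}"
    by (auto simp: upath_def)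
  then show ?case using Cons.IH uwalk_uverts[of G "across u e" es v e]
    by (auto simp: upath_def)
qed simp

lemma upath_suffix:
  "upath G u es v \<Longrightarrow> w \<in> set (uverts u es) \<Longrightarrow> \<exists>es'. upath G w es' v"
proof (induction es arbitrary: u)
  case Nil
  then show ?case by auto
next
  case (Cons e es)
  then have "upath G (across u e) es v" by (auto simp: upath_def)
  then show ?case using Cons by auto
qed

text \<open>A path is extended at its front; if the new vertex already occurs on it, the part
  starting there is taken instead.\<close>

lemma reach_upath: "(u, v) \<in> reach H \<Longrightarrow> \<exists>es. upath H u es v"
  unfolding reach_def
proof (induction rule: converse_rtrancl_induct)
  case base
  have "upath H v [] v" by (simp add: upath_def)
  then show ?case by blast
next
  case (step u w)
  then obtain es where es: "upath H w es v" by blast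
  show ?case
  proof (cases "u \<in> set (uverts w es)")
    case True
    then show ?thesis using upath_suffix es by blast
  next
    case False
    obtain e where "e \<in> H" "u \<in> {fst e, snd e}" "across u e = w"
      using step(1) by (auto simp: across_def)
    then have "upath H u (e # es) v" using es False by (simp add: upath_def)
    then show ?thesis by blast
  qed
qed

text \<open>These are the arrows on which a greedy run has already decided when it reaches
  \<open>p\<close>.\<close>

definition below :: "(nat \<times> nat) set \<Rightarrow> nat \<times> nat \<Rightarrow> (nat \<times> nat) set" where
  "below H p = {e \<in> H. lex_less e p}"

lemma below_mono: "lex_less p q \<Longrightarrow> below H p \<subseteq> below H q"
  using lex_less_trans[of _ p q] by (auto simp: below_def simp del: split_paired_All)

lemma upath_subset: "upath G u es v \<Longrightarrow> set es \<subseteq> G"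
  unfolding upath_def using uwalk_subset by blast

lemma upath_mono: "upath G u es v \<Longrightarrow> set es \<subseteq> H \<Longrightarrow> upath H u es v"
  unfolding upath_def using uwalk_mono by blast

text \<open>This turns the path condition for \<open>Star\<close> entries into a statement about
  connectivity.\<close>

lemma reach_below_upath:
  "(u, v) \<in> reach (below G p) \<longleftrightarrow> (\<exists>es. upath G u es v \<and> (\<forall>a\<in>set es. lex_less a p))"
proof
  assume "(u, v) \<in> reach (below G p)"
  then obtain es where es: "upath (below G p) u es v" using reach_upath by blast
  then have "set es \<subseteq> G" "\<forall>a\<in>set es. lex_less a p"
    using upath_subset[OF es] by (auto simp: below_def)
  then show "\<exists>es. upath G u es v \<and> (\<forall>a\<in>set es. lex_less a p)"
    using es upath_mono by blast
next
  assume "\<exists>es. upath G u es v \<and> (\<forall>a\<in>set es. lex_less a p)"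
  then obtain es where es: "uwalk G u es v" "\<forall>a\<in>set es. lex_less a p"
    by (auto simp: upath_def)
  then have "set es \<subseteq> below G p" using uwalk_subset[OF es(1)] by (auto simp: below_def)
  then show "(u, v) \<in> reach (below G p)" using es uwalk_reach by blast
qed

text \<open>The lexicographically minimal spanning forest of \<open>P\<close>, i.e.\ the output of Kruskal's
  algorithm.\<close>

definition kruskal :: "(nat \<times> nat) set \<Rightarrow> (nat \<times> nat) set" where
  "kruskal P = {e \<in> P. e \<notin> reach (below P e)}"

lemma kruskal_subset: "kruskal P \<subseteq> P"
  by (auto simp: kruskal_def)

text \<open>The ends of a discarded arrow are already joined by smaller arrows, and by induction
  those can be replaced by retained ones. Discarding therefore never changes the components.\<close>

lemma reach_below_kruskal: "reach (below (kruskal P) p) = reach (below P p)"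
proof
  show "reach (below (kruskal P) p) \<subseteq> reach (below P p)"
    by (intro reach_mono) (auto simp: below_def kruskal_def)
  \<comment> \<open>The bound is inclusive so that a retained arrow can serve as its own witness;
    the strict bound \<open>p\<close> returns at the end because \<open>e\<close> lies below
    \<open>p\<close>.\<close>
  define upto where "upto e = {d \<in> kruskal P. d = e \<or> lex_less d e}" for e
  have *: "e \<in> P \<Longrightarrow> e \<in> reach (upto e)" for e
  proof (induction e rule: lex_less_induct)
    case (less e)
    show ?case
    proof (cases "e \<in> kruskal P")
      case True
      then show ?thesis by (intro reach_edge) (simp add: upto_def)
    next
      case False
      have "below P e \<subseteq> reach (upto e)"
      proof
        fix d assume "d \<in> below P e"
        then have d: "d \<in> P" "lex_less d e" by (auto simp: below_def)
        then have "upto d \<subseteq> upto e" using lex_less_trans[of _ d e] by (auto simp: upto_def)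
        then show "d \<in> reach (upto e)" using less d reach_mono by blast
      qed
      then show ?thesis using False less.prems reach_least by (auto simp: kruskal_def)
    qed
  qed
  show "reach (below P p) \<subseteq> reach (below (kruskal P) p)"
  proof (intro reach_least subsetI)
    fix e assume "e \<in> below P p"
    then have e: "e \<in> P" "lex_less e p" by (auto simp: below_def)
    then have "upto e \<subseteq> below (kruskal P) p"
      using lex_less_trans[of _ e p] by (auto simp: upto_def below_def)
    then show "e \<in> reach (below (kruskal P) p)" using * e reach_mono by blast
  qed
qed

text \<open>The greatest arrow \<open>m\<close> of the walk would be bypassed by smaller arrows: the remaining arrows
  of the walk are distinct from \<open>m\<close>.\<close>

lemma kruskal_walk:
  assumes "uwalk (kruskal P) u es v" "distinct es" "a \<in> set es"
  shows "(u, v) \<notin> reach (below (kruskal P) a)"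
proof
  let ?G = "kruskal P"
  assume uv: "(u, v) \<in> reach (below ?G a)"
  obtain m where m: "m \<in> set es" "\<forall>e\<in>set es. e = m \<or> lex_less e m"
    using ex_lex_greatest assms(3) by (metis list.set_cases list.distinct(1))
  obtain xs ys where es: "es = xs @ m # ys" using m(1) by (meson split_list)
  obtain w where w: "uwalk ?G u xs w" "uwalk ?G (across w m) ys v" "w \<in> {fst m, snd m}" "m \<in> ?G"
    using assms(1) by (auto simp: es uwalk_append)
  let ?R = "reach (below ?G m)"
  have "set xs \<subseteq> below ?G m" "set ys \<subseteq> below ?G m"
    using m(2) assms(2) uwalk_subset[OF assms(1)] by (auto simp: es below_def)
  then have 1: "(u, w) \<in> ?R" "(across w m, v) \<in> ?R" using w uwalk_reach by blast+
  have "a = m \<or> lex_less a m" using bspec[OF m(2) assms(3)] .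
  then have "below ?G a \<subseteq> below ?G m" using below_mono[of a m ?G] by (elim disjE) simp_all
  then have "(u, v) \<in> ?R" using uv reach_mono by blast
  then have "(w, across w m) \<in> ?R" using 1 reach_trans reach_sym by blast
  then have "m \<in> ?R" using w(3) reach_sym by (cases m) (auto simp: across_def split: if_splits)
  then show False using w(4) by (simp add: reach_below_kruskal) (simp add: kruskal_def)
qed

lemma kruskal_not_reach_below: "e \<in> kruskal P \<Longrightarrow> e \<notin> reach (below (kruskal P) e)"
  by (simp add: reach_below_kruskal) (simp add: kruskal_def)

lemma kruskal_upath:
  "upath (kruskal P) u es v \<Longrightarrow> a \<in> set es \<Longrightarrow> (u, v) \<notin> reach (below (kruskal P) a)"
  using kruskal_walk upath_distinct unfolding upath_def by blast

text \<open>A path between the ends of \<open>e\<close> that avoids \<open>e\<close> either has only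
  smaller arrows, and then \<open>e\<close> would have been discarded, or has a greater arrow
  \<open>a\<close>, and then \<open>e\<close> itself joins the ends of the path below
  \<open>a\<close>, against \<open>kruskal_upath\<close>. The bridge property is what
  \<open>ex_scaling\<close> requires.\<close>

lemma kruskal_bridge:
  assumes "e \<in> kruskal P" shows "e \<notin> reach (kruskal P - {e})"
proof
  let ?G = "kruskal P"
  assume e: "e \<in> reach (?G - {e})"
  obtain i j where ij: "e = (i, j)" by (cases e)
  obtain es where es: "upath (?G - {e}) i es j" using reach_upath e unfolding ij by blast
  then have sub: "set es \<subseteq> ?G - {e}" by (rule upath_subset)
  then have p: "upath ?G i es j" using es upath_mono by blast
  show False
  proof (cases "\<forall>a\<in>set es. lex_less a e")
    case True
    then show False using p assms kruskal_not_reach_below reach_below_upath unfolding ij by blast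
  next
    case False
    then obtain a where a: "a \<in> set es" "lex_less e a" using sub lex_less_linear by blast
    then have "e \<in> reach (below ?G a)" using assms by (intro reach_edge) (simp add: below_def)
    then show False using kruskal_upath[OF p a(1)] by (simp add: ij)
  qed
qed

lemma kruskal_forest:
  assumes "P \<subseteq> {..<n} \<times> {..<n}" shows "forest n (kruskal P)"
  unfolding forest_def
proof
  show "kruskal P \<subseteq> {..<n} \<times> {..<n}" using assms kruskal_subset by blast
  show "\<nexists>u es. ucycle (kruskal P) u es"
  proof
    assume "\<exists>u es. ucycle (kruskal P) u es"
    then obtain u es where "es \<noteq> []" "uwalk (kruskal P) u es u" "distinct es"
      by (auto simp: ucycle_def)
    \<comment> \<open>The ends of a cycle coincide, so they are trivially joined below any of its
      arrows; the first one is taken.\<close>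
    then show False using kruskal_walk[of P u es u "hd es"] by simp
  qed
qed

section \<open>Star matrices of forests in closed form\<close>

definition star_of :: "nat \<Rightarrow> (nat \<times> nat) set \<Rightarrow> star_entry mat" where
  "star_of n G = mat n n (\<lambda>(i, j). if i = j then Star else if (i, j) \<in> G then One
     else if (i, j) \<in> reach (below G (i, j)) then Star else Zero)"

lemma forest_no_loop: "forest n G \<Longrightarrow> (i, i) \<notin> G"
proof
  assume "forest n G" "(i, i) \<in> G"
  moreover from this(2) have "ucycle G i [(i, i)]" by (simp add: ucycle_def across_def)
  ultimately show False by (auto simp: forest_def)
qed

lemma upath_edge: "(i, j) \<in> G \<Longrightarrow> i \<noteq> j \<Longrightarrow> upath G i [(i, j)] j"
  by (simp add: upath_def across_def)

text \<open>The point is that the three conditions never contradict each other: the greedy choice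
  excludes a greater arrow on a path wherever the entry is \<open>One\<close> or
  \<open>Star\<close>.\<close>

lemma star_mat_of_kruskal:
  assumes "P \<subseteq> {..<n} \<times> {..<n}"
  shows "star_mat_of_forest n (kruskal P) (star_of n (kruskal P))"
proof -
  let ?G = "kruskal P" and ?S = "star_of n (kruskal P)"
  have conditions: "((i, j) \<in> ?G \<longrightarrow> ?S $$ (i, j) = One) \<and>
       ((\<nexists>es. upath ?G i es j) \<or> (\<exists>es. upath ?G i es j \<and> (\<exists>a\<in>set es. lex_less (i, j) a))
          \<longrightarrow> ?S $$ (i, j) = Zero) \<and>
       ((\<exists>es. upath ?G i es j \<and> (\<forall>a\<in>set es. lex_less a (i, j))) \<longrightarrow> ?S $$ (i, j) = Star)"
    if ij: "i < n" "j < n" "i \<noteq> j" for i j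
  proof -
    have S: "?S $$ (i, j) = (if (i, j) \<in> ?G then One
      else if (i, j) \<in> reach (below ?G (i, j)) then Star else Zero)"
      using ij by (simp add: star_of_def)
    \<comment> \<open>A greater arrow \<open>a\<close> would be bypassed: either
      \<open>(i, j)\<close> itself or the smaller arrows joining \<open>i\<close> and
      \<open>j\<close> lie below \<open>a\<close>.\<close>
    have no_greater: "\<not> lex_less (i, j) a" if "upath ?G i es j" "a \<in> set es"
      and "(i, j) \<in> ?G \<or> (i, j) \<in> reach (below ?G (i, j))" for es a
    proof
      assume less: "lex_less (i, j) a"
      then have "below ?G (i, j) \<subseteq> below ?G a" by (rule below_mono)
      moreover have "(i, j) \<in> reach (below ?G a)" if "(i, j) \<in> ?G"
        using that less by (intro reach_edge) (simp add: below_def)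
      ultimately have "(i, j) \<in> reach (below ?G a)"
        using \<open>(i, j) \<in> ?G \<or> (i, j) \<in> reach (below ?G (i, j))\<close> reach_mono by blast
      then show False using kruskal_upath that by blast
    qed
    have "\<exists>es. upath ?G i es j" if "(i, j) \<in> ?G \<or> (i, j) \<in> reach (below ?G (i, j))"
      using that upath_edge ij(3) reach_below_upath[of i j ?G] by blast
    then show ?thesis
      using S no_greater kruskal_not_reach_below[of "(i, j)" P] reach_below_upath[of i j ?G "(i, j)"]
      by (auto split: if_splits)
  qed
  then show ?thesis
    using kruskal_forest[OF assms] by (auto simp: star_mat_of_forest_def star_of_def)
qed

text \<open>The three conditions cover all off-diagonal positions. If \<open>(i, j)\<close> is no
  arrow and its ends are not joined by smaller arrows, then every path has an arrow that is not
  smaller, and by linearity it is greater.\<close>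

lemma star_mat_of_forest_unique:
  assumes "star_mat_of_forest n G S" shows "S = star_of n G"
proof (rule eq_matI)
  have S: "S \<in> carrier_mat n n" using assms by (simp add: star_mat_of_forest_def)
  then show "dim_row S = dim_row (star_of n G)" "dim_col S = dim_col (star_of n G)"
    by (auto simp: star_of_def)
  fix i j assume "i < dim_row (star_of n G)" "j < dim_col (star_of n G)"
  then have ij: "i < n" "j < n" by (auto simp: star_of_def)
  show "S $$ (i, j) = star_of n G $$ (i, j)"
  proof (cases "i = j")
    case True
    then show ?thesis using assms ij by (simp add: star_mat_of_forest_def star_of_def)
  next
    case False
    then have c: "(i, j) \<in> G \<longrightarrow> S $$ (i, j) = One"
      "((\<nexists>es. upath G i es j) \<or> (\<exists>es. upath G i es j \<and> (\<exists>a\<in>set es. lex_less (i, j) a)))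
          \<longrightarrow> S $$ (i, j) = Zero"
      "(\<exists>es. upath G i es j \<and> (\<forall>a\<in>set es. lex_less a (i, j))) \<longrightarrow> S $$ (i, j) = Star"
      using assms ij unfolding star_mat_of_forest_def by blast+
    show ?thesis
    proof (cases "(i, j) \<in> G \<or> (i, j) \<in> reach (below G (i, j))")
      case True
      then show ?thesis using c(1,3) ij False reach_below_upath[of i j G "(i, j)"]
        by (auto simp: star_of_def)
    next
      case out: False
      then have "a \<in> set es \<Longrightarrow> upath G i es j \<Longrightarrow> a \<noteq> (i, j)" for a es
        using upath_subset by blast
      then have "(\<nexists>es. upath G i es j) \<or> (\<exists>es. upath G i es j \<and> (\<exists>a\<in>set es. lex_less (i, j) a))"
        using out lex_less_linear reach_below_upath[of i j G "(i, j)"] by blast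
      then show ?thesis using c(2) out ij False by (simp add: star_of_def)
    qed
  qed
qed

text \<open>The forest can be read off its star matrix because a forest has no loops and the
  diagonal carries only \<open>Star\<close>. Hence the description in \<open>graph_of\<close> is
  definite.\<close>

lemma star_mat_of_forest_graph:
  assumes "star_mat_of_forest n G S"
  shows "G = {(i, j). i < n \<and> j < n \<and> S $$ (i, j) = One}"
proof -
  have f: "forest n G" using assms by (simp add: star_mat_of_forest_def)
  then have "i < n \<and> j < n \<and> i \<noteq> j" if "(i, j) \<in> G" for i j
    using that forest_no_loop[OF f] by (auto simp: forest_def)
  then show ?thesis unfolding star_mat_of_forest_unique[OF assms]
    by (auto simp: star_of_def split: if_splits)
qed

lemma graph_of_eq: "star_mat_of_forest n G S \<Longrightarrow> graph_of n S = G"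
  unfolding graph_of_def using star_mat_of_forest_graph by (intro the_equality) blast+

section \<open>Zero patterns and the forests they determine\<close>

definition support :: "nat \<Rightarrow> 'a::zero mat \<Rightarrow> (nat \<times> nat) set" where
  "support n M = {(i, j). i < n \<and> j < n \<and> i \<noteq> j \<and> M $$ (i, j) \<noteq> 0}"

text \<open>An entry of \<open>M\<close> off the forest can only be nonzero if smaller arrows of \<open>G\<close> join its
  vertices, which is the greedy criterion of Kruskal's algorithm.\<close>

lemma star_mat_of_forest_kruskal:
  fixes M :: "'a::zero_neq_one mat"
  assumes S: "star_mat_of_forest n G S" and M: "M \<in> star_set n S"
  shows "G = kruskal (support n M)"
proof -
  let ?P = "support n M"
  note S_eq = star_mat_of_forest_unique[OF S]
  have f: "forest n G" using S by (simp add: star_mat_of_forest_def)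
  have GP: "G \<subseteq> ?P"
  proof
    fix e assume e: "e \<in> G"
    obtain i j where ij: "e = (i, j)" by (cases e)
    then have "i < n" "j < n" "i \<noteq> j" using f e forest_no_loop by (auto simp: forest_def)
    then show "e \<in> ?P" using M e unfolding S_eq ij by (simp add: star_set_def star_of_def support_def)
  qed
  have PG: "e \<in> G \<or> e \<in> reach (below G e)" if "e \<in> ?P" for e
    using M that unfolding S_eq
    by (cases e) (auto simp: star_set_def star_of_def support_def split: if_splits)
  \<comment> \<open>Otherwise the same entry would have to be both \<open>One\<close> and
    \<open>Star\<close>.\<close>
  have greedy: "e \<notin> reach (below G e)" if "e \<in> G" for e
  proof
    assume r: "e \<in> reach (below G e)"
    obtain i j where ij: "e = (i, j)" by (cases e)
    then have "i < n" "j < n" "i \<noteq> j" using f that forest_no_loop by (auto simp: forest_def)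
    then have "S $$ (i, j) = One" "S $$ (i, j) = Star"
      using S that r reach_below_upath[of i j G "(i, j)"] unfolding ij star_mat_of_forest_def
      by blast+
    then show False by simp
  qed
  \<comment> \<open>By \<open>PG\<close>, each arrow of the support lies in \<open>G\<close> or is
    bypassed by smaller arrows of \<open>G\<close>, so the greedy tests in \<open>G\<close> and in
    the support agree.\<close>
  have reach_eq: "reach (below G p) = reach (below ?P p)" for p
  proof
    show "reach (below G p) \<subseteq> reach (below ?P p)" using GP by (intro reach_mono) (auto simp: below_def)
    show "reach (below ?P p) \<subseteq> reach (below G p)"
    proof (intro reach_least subsetI)
      fix e assume "e \<in> below ?P p"
      then have e: "e \<in> ?P" "lex_less e p" by (auto simp: below_def)
      then have "below G e \<subseteq> below G p" using below_mono by blast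
      moreover have "e \<in> G \<Longrightarrow> e \<in> below G p" using e by (simp add: below_def)
      ultimately show "e \<in> reach (below G p)" using PG[OF e(1)] reach_mono reach_edge by blast
    qed
  qed
  show ?thesis using GP PG greedy reach_eq by (auto simp: kruskal_def)
qed

text \<open>A nonzero off-diagonal entry outside the forest belongs to a discarded arrow. Its ends
  are joined by smaller arrows, so the star matrix has \<open>Star\<close> there.\<close>

lemma star_set_kruskal:
  fixes M :: "'a::zero_neq_one mat"
  assumes "M \<in> carrier_mat n n" and "\<And>i j. (i, j) \<in> kruskal (support n M) \<Longrightarrow> M $$ (i, j) = 1"
  shows "M \<in> star_set n (star_of n (kruskal (support n M)))"
  using assms
  by (auto simp: star_set_def star_of_def reach_below_kruskal split: if_splits)
    (auto simp: kruskal_def support_def)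

lemma star_set_kruskal_entry:
  fixes M :: "'a::zero_neq_one mat"
  assumes "star_mat_of_forest n G S" and "M \<in> star_set n S" and "(i, j) \<in> kruskal (support n M)"
  shows "M $$ (i, j) = 1"
proof -
  have "i < n" "j < n" "i \<noteq> j" using assms(3) kruskal_subset by (auto simp: support_def)
  then show ?thesis
    using assms star_mat_of_forest_kruskal[OF assms(1,2)] unfolding star_set_def star_mat_of_forest_def by auto
qed

lemma support_subset: "support n M \<subseteq> {..<n} \<times> {..<n}"
  by (auto simp: support_def)

text \<open>This eliminates star matrices: being canonical becomes a normalisation of the entries on
  the forest of the support.\<close>

lemma canonical_star_mat_iff:
  fixes M :: "'a::zero_neq_one mat"
  assumes "M \<in> carrier_mat n n"
  shows "(\<exists>S. canonical_star_mat n S \<and> M \<in> star_set n S) \<longleftrightarrow>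
    (\<forall>(i, j) \<in> kruskal (support n M). M $$ (i, j) = 1)"
proof
  assume "\<exists>S. canonical_star_mat n S \<and> M \<in> star_set n S"
  then show "\<forall>(i, j) \<in> kruskal (support n M). M $$ (i, j) = 1"
    using star_set_kruskal_entry unfolding canonical_star_mat_def by fast
next
  assume "\<forall>(i, j) \<in> kruskal (support n M). M $$ (i, j) = 1"
  then have "M \<in> star_set n (star_of n (kruskal (support n M)))"
    using star_set_kruskal[OF assms] by blast
  then show "\<exists>S. canonical_star_mat n S \<and> M \<in> star_set n S"
    using star_mat_of_kruskal[OF support_subset] unfolding canonical_star_mat_def by blast
qed

text \<open>The support determines the forest and the forest determines the star matrix, so both
  definite descriptions have unique solutions.\<close>

lemma type_of_canonical_eq:
  fixes C :: "'a::{field, linorder} mat \<times> 'a mat"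
  assumes "canonical_pair n C"
  shows "type_of_canonical n C = kruskal (support n (snd C))"
proof -
  obtain S G where S: "star_mat_of_forest n G S" "snd C \<in> star_set n S"
    using assms by (auto simp: canonical_pair_def canonical_star_mat_def)
  have "(THE S. canonical_star_mat n S \<and> snd C \<in> star_set n S) = S"
  proof (rule the_equality)
    show "canonical_star_mat n S \<and> snd C \<in> star_set n S"
      using S by (auto simp: canonical_star_mat_def)
    fix S' assume "canonical_star_mat n S' \<and> snd C \<in> star_set n S'"
    then obtain G' where S': "star_mat_of_forest n G' S'" "snd C \<in> star_set n S'"
      by (auto simp: canonical_star_mat_def)
    then show "S' = S"
      using S star_mat_of_forest_kruskal star_mat_of_forest_unique by metis
  qed
  then show ?thesis
    using graph_of_eq[OF S(1)] star_mat_of_forest_kruskal[OF S] by (simp add: type_of_canonical_def)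
qed

text \<open>Arrows are added one at a time. A new arrow joins two different components, and
  rescaling one whole component by a constant factor solves the new equation without disturbing the
  old ones.\<close>

lemma ex_scaling:
  fixes w :: "nat \<times> nat \<Rightarrow> 'a::field"
  assumes "finite G" and "\<And>e. e \<in> G \<Longrightarrow> e \<notin> reach (G - {e})" and "\<And>e. e \<in> G \<Longrightarrow> w e \<noteq> 0"
  shows "\<exists>t. (\<forall>i. t i \<noteq> 0) \<and> (\<forall>(i, j) \<in> G. t i * w (i, j) = t j)"
  using assms
proof (induction G rule: finite_induct)
  case empty
  show ?case by (intro exI[of _ "\<lambda>_. 1"]) simp
next
  case (insert e G)
  have "d \<notin> reach (G - {d})" if "d \<in> G" for d
    using insert.prems(1)[of d] that reach_mono[of "G - {d}" "insert e G - {d}"] by blast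
  then obtain t where t: "\<forall>i. t i \<noteq> 0" "\<forall>(i, j) \<in> G. t i * w (i, j) = t j"
    using insert by auto
  obtain i j where ij: "e = (i, j)" by (cases e)
  have nij: "(i, j) \<notin> reach G" using insert.prems(1)[of e] insert.hyps(2) ij by simp
  have w: "w (i, j) \<noteq> 0" using insert.prems(2) ij by blast
  \<comment> \<open>The component of \<open>i\<close> is multiplied by the factor that turns
    \<open>t i * w (i, j)\<close> into \<open>t j\<close>; as \<open>j\<close> lies in another
    component, \<open>t j\<close> stays fixed.\<close>
  define s where "s v = (if (i, v) \<in> reach G then t v * (t j / (t i * w (i, j))) else t v)" for v
  have "s v \<noteq> 0" for v using t(1) w by (simp add: s_def)
  moreover have "s k * w (k, l) = s l" if "(k, l) \<in> G" for k l
  proof -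
    have "(i, k) \<in> reach G \<longleftrightarrow> (i, l) \<in> reach G"
      using reach_edge[OF that] reach_trans reach_sym by blast
    moreover have "t l = t k * w (k, l)" using t(2) that by auto
    ultimately show ?thesis by (simp add: s_def)
  qed
  moreover have "s i * w (i, j) = s j" using nij t(1) w by (simp add: s_def)
  ultimately show ?case by (intro exI[of _ s]) (auto simp: ij)
qed

section \<open>Evaluation of noncommutative polynomials\<close>

text \<open>Linear extension from the basis of a monoid algebra serves both kinds of polynomials:
  \<open>g\<close> is the value of a commutative monomial or a matrix entry of an evaluated
  word.\<close>

definition lin_ext :: "('b \<Rightarrow> 'a::comm_ring_1) \<Rightarrow> ('b \<Rightarrow>\<^sub>0 'a) \<Rightarrow> 'a" where
  "lin_ext g f = (\<Sum>w\<in>Poly_Mapping.keys f. Poly_Mapping.lookup f w * g w)"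

lemma lin_ext_superset:
  "finite W \<Longrightarrow> Poly_Mapping.keys f \<subseteq> W \<Longrightarrow>
    lin_ext g f = (\<Sum>w\<in>W. Poly_Mapping.lookup f w * g w)"
  unfolding lin_ext_def by (rule sum.mono_neutral_left) (auto simp: in_keys_iff)

lemma lin_ext_zero [simp]: "lin_ext g 0 = 0"
  by (simp add: lin_ext_def)

lemma lin_ext_add: "lin_ext g (f + f') = lin_ext g f + lin_ext g f'"
proof -
  let ?W = "Poly_Mapping.keys f \<union> Poly_Mapping.keys f'"
  have "Poly_Mapping.keys (f + f') \<subseteq> ?W" by (rule keys_add)
  then show ?thesis
    by (simp add: lin_ext_superset[of ?W] lookup_add distrib_right sum.distrib)
qed

lemma lin_ext_sum: "lin_ext g (\<Sum>i\<in>I. f i) = (\<Sum>i\<in>I. lin_ext g (f i))"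
  by (induction I rule: infinite_finite_induct) (auto simp: lin_ext_add)

lemma lin_ext_single: "lin_ext g (Poly_Mapping.single w c) = c * g w"
  by (simp add: lin_ext_def)

lemma poly_mapping_sum_single:
  fixes f :: "'b \<Rightarrow>\<^sub>0 'a::comm_monoid_add"
  shows "f = (\<Sum>w\<in>Poly_Mapping.keys f. Poly_Mapping.single w (Poly_Mapping.lookup f w))"
  by (rule poly_mapping_eqI) (simp add: lookup_sum lookup_single when_def in_keys_iff)

lemma lin_ext_mult:
  fixes f f' :: "'b::monoid_add \<Rightarrow>\<^sub>0 'a::comm_ring_1"
  assumes "\<And>u v. g (u + v) = g u * g v"
  shows "lin_ext g (f * f') = lin_ext g f * lin_ext g f'"
proof -
  let ?k = Poly_Mapping.keys and ?l = Poly_Mapping.lookup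
  have "f * f' = (\<Sum>u\<in>?k f. Poly_Mapping.single u (?l f u)) * (\<Sum>v\<in>?k f'. Poly_Mapping.single v (?l f' v))"
    using poly_mapping_sum_single[of f] poly_mapping_sum_single[of f'] by simp
  also have "\<dots> = (\<Sum>u\<in>?k f. \<Sum>v\<in>?k f'. Poly_Mapping.single (u + v) (?l f u * ?l f' v))"
    by (simp add: sum_product mult_single)
  finally have "lin_ext g (f * f') = (\<Sum>u\<in>?k f. \<Sum>v\<in>?k f'. ?l f u * ?l f' v * (g u * g v))"
    by (simp add: lin_ext_sum lin_ext_single assms)
  then show ?thesis by (simp add: lin_ext_def sum_product ac_simps)
qed

definition monom_eval :: "('v \<Rightarrow> 'a::comm_ring_1) \<Rightarrow> ('v \<Rightarrow>\<^sub>0 nat) \<Rightarrow> 'a" where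
  "monom_eval \<rho> m = (\<Prod>v\<in>Poly_Mapping.keys m. \<rho> v ^ Poly_Mapping.lookup m v)"

lemma monom_eval_superset:
  "finite W \<Longrightarrow> Poly_Mapping.keys m \<subseteq> W \<Longrightarrow>
    monom_eval \<rho> m = (\<Prod>v\<in>W. \<rho> v ^ Poly_Mapping.lookup m v)"
  unfolding monom_eval_def by (rule prod.mono_neutral_left) (auto simp: in_keys_iff)

lemma monom_eval_add: "monom_eval \<rho> (m + m') = monom_eval \<rho> m * monom_eval \<rho> m'"
proof -
  let ?W = "Poly_Mapping.keys m \<union> Poly_Mapping.keys m'"
  have "Poly_Mapping.keys (m + m') \<subseteq> ?W" by (rule keys_add)
  then show ?thesis
    by (simp add: monom_eval_superset[of ?W] lookup_add power_add prod.distrib)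
qed

lemma gpoly_eval_lin_ext: "gpoly_eval \<rho> = lin_ext (monom_eval \<rho>)"
  by (intro ext) (simp add: gpoly_eval_def lin_ext_def monom_eval_def)

lemma gpoly_eval_gconst [simp]: "gpoly_eval \<rho> (gconst c) = c"
  by (simp add: gpoly_eval_lin_ext gconst_def lin_ext_single) (simp add: monom_eval_def)

lemma gpoly_eval_gvar [simp]: "gpoly_eval \<rho> (gvar v) = \<rho> v"
  by (simp add: gpoly_eval_lin_ext gvar_def lin_ext_single) (simp add: monom_eval_def)

lemma gconst_0 [simp]: "gconst 0 = 0" and gconst_1 [simp]: "gconst 1 = 1"
  by (simp_all add: gconst_def)

lemma gpoly_eval_mult: "gpoly_eval \<rho> (p * q) = gpoly_eval \<rho> p * gpoly_eval \<rho> q"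
  unfolding gpoly_eval_lin_ext by (rule lin_ext_mult) (rule monom_eval_add)

text \<open>As a ring homomorphism, evaluation is compatible with matrix products when applied
  entrywise.\<close>

lemma gpoly_eval_hom: "comm_ring_hom (gpoly_eval \<rho>)"
proof
  show "gpoly_eval \<rho> 1 = 1" using gpoly_eval_gconst[of \<rho> 1] by simp
qed (simp_all add: gpoly_eval_mult, simp_all add: gpoly_eval_lin_ext lin_ext_add)

section \<open>Evaluation of words and noncommutative polynomials at pairs of matrices\<close>

fun word_eval :: "nat \<Rightarrow> 'a::comm_ring_1 mat \<times> 'a mat \<Rightarrow> letter list \<Rightarrow> 'a mat" where
  "word_eval n A [] = 1\<^sub>m n"
| "word_eval n A (k # w) = component A k * word_eval n A w"

definition nc_eval :: "nat \<Rightarrow> 'a::comm_ring_1 ncpoly \<Rightarrow> 'a mat \<times> 'a mat \<Rightarrow> 'a mat" where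
  "nc_eval n f A = mat n n (\<lambda>(i, j). lin_ext (\<lambda>w. word_eval n A w $$ (i, j)) f)"

definition pairs :: "nat \<Rightarrow> ('a mat \<times> 'a mat) set" where
  "pairs n = carrier_mat n n \<times> carrier_mat n n"

lemma component_carrier: "A \<in> pairs n \<Longrightarrow> component A k \<in> carrier_mat n n"
  by (cases k) (auto simp: pairs_def)

lemma word_eval_carrier: "A \<in> pairs n \<Longrightarrow> word_eval n A w \<in> carrier_mat n n"
  by (induction w) (simp_all add: mult_carrier_mat[OF component_carrier])

lemma generic_mat_carrier: "generic_mat n k \<in> carrier_mat n n"
  by (simp add: generic_mat_def)

lemma generic_word_carrier: "generic_word n w \<in> carrier_mat n n"
  by (induction w) (simp_all add: mult_carrier_mat[OF generic_mat_carrier])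

definition entry_of :: "'a mat \<times> 'a mat \<Rightarrow> letter \<times> nat \<times> nat \<Rightarrow> 'a" where
  "entry_of A = (\<lambda>(k, i, j). component A k $$ (i, j))"

lemma subst_pair_entry_of: "subst_pair F A = map_mat (gpoly_eval (entry_of A)) F"
  by (simp add: subst_pair_def entry_of_def)

lemma subst_generic_word:
  assumes "A \<in> pairs n" shows "subst_pair (generic_word n w) A = word_eval n A w"
proof -
  interpret comm_ring_hom "gpoly_eval (entry_of A)" by (rule gpoly_eval_hom)
  have gen: "map_mat (gpoly_eval (entry_of A)) (generic_mat n k) = component A k" for k
    using component_carrier[OF assms, of k]
    by (intro eq_matI) (auto simp: generic_mat_def entry_of_def)
  show ?thesis unfolding subst_pair_entry_of
  proof (induction w)
    case (Cons k w)
    then show ?case using gen mat_hom_mult[OF generic_mat_carrier generic_word_carrier] by simp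
  qed (simp add: mat_hom_one)
qed

text \<open>Substitution is a homomorphism, so the detour through generic matrices can be replaced
  by direct evaluation at the pair.\<close>

lemma subst_nc_at_generic:
  assumes "A \<in> pairs n" shows "subst_pair (nc_at_generic n f) A = nc_eval n f A"
proof -
  interpret comm_ring_hom "gpoly_eval (entry_of A)" by (rule gpoly_eval_hom)
  have word: "gpoly_eval (entry_of A) (generic_word n w $$ (i, j)) = word_eval n A w $$ (i, j)"
    if "i < n" "j < n" for w i j
    using that unfolding subst_generic_word[OF assms, symmetric]
    by (simp add: subst_pair_entry_of carrier_matD[OF generic_word_carrier])
  show ?thesis
    by (rule eq_matI)
      (auto simp: subst_pair_entry_of nc_at_generic_def nc_eval_def lin_ext_def hom_sum gpoly_eval_mult word)
qed

lemma generic_word_in_alg: "generic_word n w \<in> generic_alg n"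
  by (induction w) (auto intro: generic_alg.intros)

lemma nc_at_generic_in_alg: "nc_at_generic n f \<in> generic_alg n"
proof -
  have "finite W \<Longrightarrow> mat n n (\<lambda>(i, j). \<Sum>w\<in>W. gconst (c w) * generic_word n w $$ (i, j))
    \<in> generic_alg n" for W and c :: "letter list \<Rightarrow> 'a"
  proof (induction W rule: finite_induct)
    case empty
    \<comment> \<open>The zero matrix is obtained as the zero multiple of the identity.\<close>
    have "mat n n (\<lambda>_. 0) = gconst (0::'a) \<cdot>\<^sub>m 1\<^sub>m n" by (intro eq_matI) auto
    then show ?case using generic_alg.smult[OF generic_alg.one[of n], of "0::'a"] by simp
  next
    case (insert w W)
    have eq: "mat n n (\<lambda>(i, j). \<Sum>w\<in>insert w W. gconst (c w) * generic_word n w $$ (i, j)) =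
      gconst (c w) \<cdot>\<^sub>m generic_word n w +
      mat n n (\<lambda>(i, j). \<Sum>w\<in>W. gconst (c w) * generic_word n w $$ (i, j))"
      using insert.hyps by (intro eq_matI) (auto simp: carrier_matD[OF generic_word_carrier])
    show ?case unfolding eq
      by (intro generic_alg.add generic_alg.smult generic_word_in_alg insert.IH)
  qed
  then show ?thesis by (simp add: nc_at_generic_def)
qed

lemma generic_degree_le: "generic_degree n (nc_at_generic n f) \<le> nc_degree f"
  unfolding generic_degree_def by (rule Least_le) blast

text \<open>Each polynomial of small degree gives an element of \<open>Set_zeta\<close>, and equal
  values of \<open>zeta\<close> mean simultaneous vanishing.\<close>

lemma nc_eval_eq_if_zeta_eq:
  assumes "\<forall>f \<in> Set_zeta n. f A = f B" and "A \<in> pairs n" "B \<in> pairs n" and "nc_degree f \<le> 2 * n - 1"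
  shows "nc_eval n f A = 0\<^sub>m n n \<longleftrightarrow> nc_eval n f B = 0\<^sub>m n n"
proof -
  let ?F = "nc_at_generic n f"
  have "generic_degree n ?F \<le> 2 * n - 1"
    using generic_degree_le assms(4) order_trans by blast
  then have mem: "(\<lambda>A. zeta n (subst_pair ?F A)) \<in> Set_zeta n"
    using nc_at_generic_in_alg by (auto simp: Set_zeta_def)
  have "zeta n (nc_eval n f A) = zeta n (nc_eval n f B)"
    using bspec[OF assms(1) mem]
    by (simp add: subst_nc_at_generic[OF assms(2)] subst_nc_at_generic[OF assms(3)])
  then show ?thesis by (simp add: zeta_def split: if_splits)
qed

section \<open>Behaviour of evaluation under simultaneous conjugation\<close>

lemma orbitE:
  assumes "B \<in> orbit n A"
  obtains g h where "g \<in> carrier_mat n n" "h \<in> carrier_mat n n" "g * h = 1\<^sub>m n" "h * g = 1\<^sub>m n"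
    "B = (g * fst A * h, g * snd A * h)"
  using assms by (auto simp: orbit_def)

lemma conj_mult:
  assumes "g \<in> carrier_mat n n" "h \<in> carrier_mat n n" "h * g = 1\<^sub>m n"
    and "M \<in> carrier_mat n n" "N \<in> carrier_mat n n"
  shows "(g * M * h) * (g * N * h) = g * (M * N) * (h :: 'a::comm_ring_1 mat)"
proof -
  have "(g * M * h) * (g * N * h) = g * M * (h * g) * N * h"
    using assms(1,2,4,5) by (simp add: assoc_mult_mat[of _ n n _ n _ n])
  also have "\<dots> = g * (M * N) * h"
    using assms by (simp add: assoc_mult_mat[of _ n n _ n _ n])
  finally show ?thesis .
qed

lemma word_eval_conj:
  assumes "g \<in> carrier_mat n n" "h \<in> carrier_mat n n" "g * h = 1\<^sub>m n" "h * g = 1\<^sub>m n" and "A \<in> pairs n"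
  shows "word_eval n (g * fst A * h, g * snd A * h) w = g * word_eval n A w * h"
proof (induction w)
  case Nil
  then show ?case using assms by simp
next
  case (Cons k w)
  have "component (g * fst A * h, g * snd A * h) k = g * component A k * h" by (cases k) auto
  then show ?case
    using Cons conj_mult[OF assms(1,2,4) component_carrier word_eval_carrier] assms(5) by simp
qed

lemma conj_entry:
  assumes "g \<in> carrier_mat n n" "h \<in> carrier_mat n n" "M \<in> carrier_mat n n" "i < n" "j < n"
  shows "(g * M * h) $$ (i, j) = (\<Sum>r<n. \<Sum>s<n. g $$ (i, r) * M $$ (r, s) * (h :: 'a::comm_ring_1 mat) $$ (s, j))"
  using assms by (simp add: scalar_prod_def sum_distrib_left lessThan_atLeast0 mult.assoc)

text \<open>Conjugating the pair conjugates the value of \<open>f\<close>, so each entry of the new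
  value is a linear combination of entries of the old one.\<close>

lemma nc_eval_orbit:
  assumes "B \<in> orbit n A" "A \<in> pairs n" "nc_eval n f A = 0\<^sub>m n n"
  shows "nc_eval n f B = 0\<^sub>m n n"
proof -
  obtain g h where gh: "g \<in> carrier_mat n n" "h \<in> carrier_mat n n" "g * h = 1\<^sub>m n" "h * g = 1\<^sub>m n"
    "B = (g * fst A * h, g * snd A * h)" using orbitE[OF assms(1)] .
  have zero: "lin_ext (\<lambda>w. word_eval n A w $$ (r, s)) f = 0" if "r < n" "s < n" for r s
    using arg_cong[OF assms(3), of "\<lambda>M. M $$ (r, s)"] that by (simp add: nc_eval_def)
  have "lin_ext (\<lambda>w. word_eval n B w $$ (i, j)) f = 0" if ij: "i < n" "j < n" for i j
  proof -
    let ?k = "Poly_Mapping.keys f" and ?l = "Poly_Mapping.lookup f"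
    have "lin_ext (\<lambda>w. word_eval n B w $$ (i, j)) f =
      (\<Sum>w\<in>?k. \<Sum>r<n. \<Sum>s<n. g $$ (i, r) * h $$ (s, j) * (?l w * word_eval n A w $$ (r, s)))"
      unfolding lin_ext_def gh(5) word_eval_conj[OF gh(1-4) assms(2)]
      using conj_entry[OF gh(1,2) word_eval_carrier[OF assms(2)] ij]
      by (simp add: sum_distrib_left ac_simps)
    also have "\<dots> = (\<Sum>r<n. \<Sum>s<n. \<Sum>w\<in>?k. g $$ (i, r) * h $$ (s, j) * (?l w * word_eval n A w $$ (r, s)))"
      by (subst sum.swap, rule sum.cong[OF refl], rule sum.swap)
    also have "\<dots> = (\<Sum>r<n. \<Sum>s<n. g $$ (i, r) * h $$ (s, j) * lin_ext (\<lambda>w. word_eval n A w $$ (r, s)) f)"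
      by (simp add: lin_ext_def sum_distrib_left)
    also have "\<dots> = 0" using zero by simp
    finally show ?thesis .
  qed
  then show ?thesis by (intro eq_matI) (auto simp: nc_eval_def)
qed

text \<open>The noncommutative polynomial \<open>p(x\<^sub>1) x\<^sub>2 q(x\<^sub>1)\<close>.\<close>

definition sandwich :: "'a::comm_ring_1 poly \<Rightarrow> 'a poly \<Rightarrow> 'a ncpoly" where
  "sandwich p q = (\<Sum>k\<le>degree p. \<Sum>l\<le>degree q.
     Poly_Mapping.single (replicate k L1 @ L2 # replicate l L1) (coeff p k * coeff q l))"

lemma nc_degree_sandwich: "nc_degree (sandwich p q) \<le> degree p + degree q + 1"
proof -
  have "length w \<le> degree p + degree q + 1" if w: "w \<in> Poly_Mapping.keys (sandwich p q)" for w
  proof -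
    let ?s = "\<lambda>k l. Poly_Mapping.single (replicate k L1 @ L2 # replicate l L1) (coeff p k * coeff q l)"
    obtain k where k: "k \<le> degree p" "w \<in> Poly_Mapping.keys (\<Sum>l\<le>degree q. ?s k l)"
      using subsetD[OF keys_sum w[unfolded sandwich_def]] by blast
    then obtain l where "l \<le> degree q" "w \<in> Poly_Mapping.keys (?s k l)"
      using subsetD[OF keys_sum k(2)] by blast
    then show ?thesis using k(1) by (auto split: if_splits)
  qed
  then show ?thesis by (simp add: nc_degree_def)
qed

lemma word_eval_replicate:
  "word_eval n (mat_diag n a, M) (replicate l L1) = mat_diag n (\<lambda>i. a i ^ l)"
  by (induction l) auto

lemma word_eval_append:
  "A \<in> pairs n \<Longrightarrow> word_eval n A (u @ v) = word_eval n A u * word_eval n A v"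
proof (induction u)
  case Nil
  then show ?case using word_eval_carrier[of A n v] by simp
next
  case (Cons k u)
  then show ?case
    using assoc_mult_mat[OF component_carrier[OF Cons.prems, of k]
        word_eval_carrier[OF Cons.prems, of u] word_eval_carrier[OF Cons.prems, of v]] by simp
qed

text \<open>The two diagonal factors scale rows and columns: a single word contributes
  \<open>a r ^ k * M $$ (r, s) * a s ^ l\<close>, and the double sum factors.\<close>

lemma nc_eval_sandwich:
  assumes "M \<in> carrier_mat n n" "r < n" "s < n"
  shows "nc_eval n (sandwich p q) (mat_diag n a, M) $$ (r, s) = poly p (a r) * M $$ (r, s) * poly q (a s)"
proof -
  let ?C = "(mat_diag n a, M)"
  have C: "?C \<in> pairs n" using assms by (simp add: pairs_def)
  have "word_eval n ?C (replicate k L1 @ L2 # replicate l L1) $$ (r, s) = a r ^ k * M $$ (r, s) * a s ^ l" for k l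
    using assms
    by (simp add: word_eval_append[OF C] word_eval_replicate mat_diag_mult_right[OF assms(1)]
        mat_diag_mult_left[of _ n n] ac_simps)
  then have "nc_eval n (sandwich p q) ?C $$ (r, s) =
    (\<Sum>k\<le>degree p. \<Sum>l\<le>degree q. coeff p k * coeff q l * (a r ^ k * M $$ (r, s) * a s ^ l))"
    using assms by (simp add: nc_eval_def sandwich_def lin_ext_sum lin_ext_single)
  also have "\<dots> = poly p (a r) * M $$ (r, s) * poly q (a s)"
    by (simp add: poly_altdef sum_distrib_left sum_distrib_right ac_simps)
  finally show ?thesis .
qed

text \<open>For distinct nodes this is the Lagrange basis polynomial up to a nonzero scalar.\<close>

definition root_poly :: "nat \<Rightarrow> (nat \<Rightarrow> 'a::field) \<Rightarrow> nat \<Rightarrow> 'a poly" where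
  "root_poly n a i = (\<Prod>j\<in>{..<n} - {i}. [:- a j, 1:])"

lemma degree_root_poly: "i < n \<Longrightarrow> degree (root_poly n a i) \<le> n - 1"
  unfolding root_poly_def by (rule order_trans[OF degree_prod_sum_le]) auto

lemma poly_root_poly:
  "inj_on a {..<n} \<Longrightarrow> i < n \<Longrightarrow> r < n \<Longrightarrow> poly (root_poly n a i) (a r) = 0 \<longleftrightarrow> r \<noteq> i"
  by (auto simp: root_poly_def poly_prod inj_on_def)

text \<open>The left factor kills all rows but \<open>i\<close>, the right factor all columns but
  \<open>j\<close>; the surviving entry is multiplied by nonzero scalars.\<close>

lemma nc_eval_root_poly:
  assumes "M \<in> carrier_mat n n" "inj_on a {..<n}" "i < n" "j < n"
  shows "nc_eval n (sandwich (root_poly n a i) (root_poly n a j)) (mat_diag n a, M) = 0\<^sub>m n n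
    \<longleftrightarrow> M $$ (i, j) = 0"
proof -
  let ?E = "nc_eval n (sandwich (root_poly n a i) (root_poly n a j)) (mat_diag n a, M)"
  have "?E $$ (r, s) = 0 \<longleftrightarrow> (r = i \<and> s = j \<longrightarrow> M $$ (i, j) = 0)" if "r < n" "s < n" for r s
    using that nc_eval_sandwich[OF assms(1) that] assms poly_root_poly[OF assms(2)] by auto
  moreover have "?E = 0\<^sub>m n n \<longleftrightarrow> (\<forall>r<n. \<forall>s<n. ?E $$ (r, s) = 0)"
    by (auto simp: nc_eval_def mat_eq_iff)
  ultimately show ?thesis using assms by auto
qed

text \<open>The bound arises as \<open>(n - 1) + 1 + (n - 1)\<close>, with the middle term from the
  letter \<open>L2\<close>.\<close>

lemma nc_degree_root_poly:
  "i < n \<Longrightarrow> j < n \<Longrightarrow> nc_degree (sandwich (root_poly n a i) (root_poly n a j)) \<le> 2 * n - 1"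
  using nc_degree_sandwich[of "root_poly n a i" "root_poly n a j"]
    degree_root_poly[of i n a] degree_root_poly[of j n a] by linarith

section \<open>Canonical representatives and types\<close>

lemma orbitI:
  assumes "g \<in> carrier_mat n n" "h \<in> carrier_mat n n" "g * h = 1\<^sub>m n" "h * g = 1\<^sub>m n"
  shows "(g * fst A * h, g * snd A * h) \<in> orbit n A"
  using assms by (auto simp: orbit_def)

lemma conj_conj:
  assumes "g \<in> carrier_mat n n" "h \<in> carrier_mat n n" "g' \<in> carrier_mat n n" "h' \<in> carrier_mat n n"
    and "M \<in> carrier_mat n n"
  shows "g' * (g * M * h) * h' = (g' * g) * M * (h * (h' :: 'a::comm_ring_1 mat))"
  using assms by (simp add: assoc_mult_mat[of _ n n _ n _ n])

lemma mult_inverse_mat: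
  assumes "g \<in> carrier_mat n n" "h \<in> carrier_mat n n" "g' \<in> carrier_mat n n" "h' \<in> carrier_mat n n"
    and "g * h = 1\<^sub>m n" "g' * h' = 1\<^sub>m n"
  shows "(g' * g) * (h * h') = (1\<^sub>m n :: 'a::comm_ring_1 mat)"
proof -
  have "(g' * g) * (h * h') = g' * (g * h) * h'"
    using assms(1-4) by (simp add: assoc_mult_mat[of _ n n _ n _ n])
  then show ?thesis using assms by simp
qed

lemma orbit_pairs: "A \<in> pairs n \<Longrightarrow> B \<in> orbit n A \<Longrightarrow> B \<in> pairs n"
  by (auto simp: orbit_def pairs_def intro!: mult_carrier_mat)

lemma orbit_trans:
  assumes "A \<in> pairs n" "B \<in> orbit n A" "C \<in> orbit n B"
  shows "C \<in> orbit n A"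
proof -
  obtain g h where g: "g \<in> carrier_mat n n" "h \<in> carrier_mat n n" "g * h = 1\<^sub>m n" "h * g = 1\<^sub>m n"
    "B = (g * fst A * h, g * snd A * h)" using orbitE[OF assms(2)] .
  obtain k l where k: "k \<in> carrier_mat n n" "l \<in> carrier_mat n n" "k * l = 1\<^sub>m n" "l * k = 1\<^sub>m n"
    "C = (k * fst B * l, k * snd B * l)" using orbitE[OF assms(3)] .
  have A: "fst A \<in> carrier_mat n n" "snd A \<in> carrier_mat n n" using assms(1) by (auto simp: pairs_def)
  have "C = (k * g * fst A * (h * l), k * g * snd A * (h * l))"
    using conj_conj[OF g(1,2) k(1,2)] A by (simp add: k(5) g(5))
  then show ?thesis
    using orbitI[of "k * g" n "h * l" A] mult_inverse_mat[OF g(1,2) k(1,2) g(3) k(3)]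
      mult_inverse_mat[OF k(2,1) g(2,1) k(4) g(4)] g k by simp
qed

lemma orbit_sym:
  assumes "A \<in> pairs n" "B \<in> orbit n A"
  shows "A \<in> orbit n B"
proof -
  obtain g h where g: "g \<in> carrier_mat n n" "h \<in> carrier_mat n n" "g * h = 1\<^sub>m n" "h * g = 1\<^sub>m n"
    "B = (g * fst A * h, g * snd A * h)" using orbitE[OF assms(2)] .
  have A: "fst A \<in> carrier_mat n n" "snd A \<in> carrier_mat n n" using assms(1) by (auto simp: pairs_def)
  have "A = (h * fst B * g, h * snd B * g)"
    using conj_conj[OF g(1,2) g(2,1)] A g by (simp add: prod_eq_iff)
  then show ?thesis using orbitI[OF g(2,1,4,3), of B] by simp
qed

lemma orbit_char_poly:
  assumes "A \<in> pairs n" "B \<in> orbit n A"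
  shows "char_poly (fst B) = char_poly (fst A)"
proof -
  obtain g h where g: "g \<in> carrier_mat n n" "h \<in> carrier_mat n n" "g * h = 1\<^sub>m n" "h * g = 1\<^sub>m n"
    "B = (g * fst A * h, g * snd A * h)" using orbitE[OF assms(2)] .
  have "similar_mat_wit (fst B) (fst A) g h"
    using g assms(1) by (auto simp: similar_mat_wit_def Let_def pairs_def)
  then show ?thesis using char_poly_similar unfolding similar_mat_def by blast
qed

lemma D_pairs: "A \<in> D n \<Longrightarrow> A \<in> pairs n"
  by (auto simp: D_def pairs_def)

lemma D_iff:
  "A \<in> D n \<longleftrightarrow> A \<in> pairs n \<and> finite {k. eigenvalue (fst A) k} \<and> card {k. eigenvalue (fst A) k} = n"
  by (auto simp: D_def pairs_def)

lemma eigenvalues_char_poly: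
  fixes A :: "'a::field mat \<times> 'a mat"
  shows "A \<in> pairs n \<Longrightarrow> {k. eigenvalue (fst A) k} = {k. poly (char_poly (fst A)) k = 0}"
  using eigenvalue_root_char_poly[of "fst A" n] by (auto simp: pairs_def)

lemma orbit_D: "A \<in> D n \<Longrightarrow> B \<in> orbit n A \<Longrightarrow> B \<in> D n"
  unfolding D_iff using orbit_pairs[of A n B] orbit_char_poly[of A n B]
    eigenvalues_char_poly[of A n] eigenvalues_char_poly[of B n] by simp

section \<open>Diagonal matrices and diagonalisation\<close>

lemma eigenvalues_mat_diag:
  fixes a :: "nat \<Rightarrow> 'a::field"
  shows "{k. eigenvalue (mat_diag n a) k} = a ` {..<n}"
proof -
  have "char_poly (mat_diag n a) = (\<Prod>k\<leftarrow>diag_mat (mat_diag n a). [:- k, 1:])"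
    by (rule char_poly_upper_triangular[of _ n]) (auto simp: mat_diag_def)
  moreover have "diag_mat (mat_diag n a) = map a [0..<n]"
    by (simp add: diag_mat_def mat_diag_def)
  ultimately show ?thesis
    using eigenvalue_root_char_poly[OF mat_diag_dim, of n a]
    by (auto simp: poly_prod_list prod_list_zero_iff)
qed

text \<open>A finite set has only one strictly increasing enumeration.\<close>

lemma strict_mono_on_image_eq:
  fixes a b :: "nat \<Rightarrow> 'a::linorder"
  assumes "strict_mono_on {..<n} a" "strict_mono_on {..<n} b" "a ` {..<n} = b ` {..<n}" "i < n"
  shows "a i = b i"
proof -
  have "map a [0..<n] = map b [0..<n]"
    using assms(1-3)
    by (intro strict_sorted_equal) (auto simp: sorted_wrt_iff_nth_less strict_mono_on_def lessThan_atLeast0)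
  then show ?thesis using assms(4) by (simp add: map_eq_conv)
qed

text \<open>Comparing entries gives \<open>g $$ (i, j) * a j = a i * g $$ (i, j)\<close>, which
  forces off-diagonal entries to vanish when the \<open>a i\<close> are distinct.\<close>

lemma mat_diag_commute:
  fixes g :: "'a::field mat"
  assumes g: "g \<in> carrier_mat n n" and "inj_on a {..<n}" and eq: "g * mat_diag n a = mat_diag n a * g"
  shows "g = mat_diag n (\<lambda>i. g $$ (i, i))"
proof (rule eq_matI)
  fix i j assume "i < dim_row (mat_diag n (\<lambda>i. g $$ (i, i)))" "j < dim_col (mat_diag n (\<lambda>i. g $$ (i, i)))"
  then have ij: "i < n" "j < n" by (auto simp: mat_diag_def)
  have "g $$ (i, j) * a j = a i * g $$ (i, j)"
    using arg_cong[OF eq, of "\<lambda>M. M $$ (i, j)"] ij mat_diag_mult_left[OF g] mat_diag_mult_right[OF g] by simp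
  then have "i = j \<or> g $$ (i, j) = 0" using assms(2) ij by (auto simp: inj_on_def)
  then show "g $$ (i, j) = mat_diag n (\<lambda>i. g $$ (i, i)) $$ (i, j)"
    using ij by (auto simp: mat_diag_def)
qed (use g in \<open>auto simp: mat_diag_def\<close>)

lemma mat_diag_conj:
  assumes "M \<in> carrier_mat n n"
  shows "mat_diag n d * M * mat_diag n e = mat n n (\<lambda>(i, j). d i * M $$ (i, j) * (e j :: 'a::comm_ring_1))"
  using assms by (auto simp: mat_diag_mult_left[OF assms] mat_diag_mult_right[of _ n n])

text \<open>Conjugation keeps the eigenvalues, so increasing order fixes the diagonal. The
  conjugating matrix then commutes with a diagonal matrix with distinct entries and is itself
  diagonal.\<close>

lemma orbit_diagonal:
  fixes M N :: "'a::{field, linorder} mat"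
  assumes M: "M \<in> carrier_mat n n" and orb: "(mat_diag n b, N) \<in> orbit n (mat_diag n a, M)"
    and a: "strict_mono_on {..<n} a" and b: "strict_mono_on {..<n} b"
  shows "\<forall>i<n. b i = a i"
    and "\<exists>d. (\<forall>i<n. d i \<noteq> 0) \<and> N = mat n n (\<lambda>(i, j). d i * M $$ (i, j) / d j)"
proof -
  have A: "(mat_diag n a, M) \<in> pairs n" using M by (simp add: pairs_def)
  have "b ` {..<n} = a ` {..<n}"
    using eigenvalues_char_poly[OF A] eigenvalues_char_poly[OF orbit_pairs[OF A orb]] orbit_char_poly[OF A orb]
    by (simp add: eigenvalues_mat_diag)
  then show ba: "\<forall>i<n. b i = a i" using strict_mono_on_image_eq[OF b a] by blast
  then have diag: "mat_diag n b = mat_diag n a" by (auto simp: mat_diag_def)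
  have inj: "inj_on a {..<n}" using a strict_mono_on_imp_inj_on by blast
  obtain g h where g: "g \<in> carrier_mat n n" "h \<in> carrier_mat n n" "g * h = 1\<^sub>m n" "h * g = 1\<^sub>m n"
    "(mat_diag n b, N) = (g * fst (mat_diag n a, M) * h, g * snd (mat_diag n a, M) * h)"
    using orbitE[OF orb] .
  then have conj: "mat_diag n a = g * mat_diag n a * h" "N = g * M * h" by (simp_all add: diag)
  have "mat_diag n a * g = g * mat_diag n a * (h * g)"
    using assoc_mult_mat[of "g * mat_diag n a" n n h n g n] g(1,2) by (subst conj(1)) simp
  then have "g * mat_diag n a = mat_diag n a * g"
    using g right_mult_one_mat[of "g * mat_diag n a" n n] by simp
  from mat_diag_commute[OF g(1) inj this] obtain d where d: "g = mat_diag n d" by blast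
  \<comment> \<open>The inverse is shown to be diagonal by the same argument;
    \<open>g * h = 1\<^sub>m n\<close> then relates the two diagonals.\<close>
  have "h * mat_diag n a = (h * g) * mat_diag n a * h"
    using g(1,2) by (subst conj(1)) (simp add: assoc_mult_mat[of _ n n _ n _ n])
  then have "h * mat_diag n a = mat_diag n a * h"
    using g by (simp add: left_mult_one_mat[OF mat_diag_dim])
  from mat_diag_commute[OF g(2) inj this] obtain e where e: "h = mat_diag n e" by blast
  have "mat_diag n (\<lambda>i. d i * e i) = 1\<^sub>m n" using g(3) by (simp add: d e)
  then have diag_one: "mat_diag n (\<lambda>i. d i * e i) $$ (i, i) = 1\<^sub>m n $$ (i, i)" for i by simp
  have one: "d i * e i = 1" if "i < n" for i using diag_one[of i] that by (simp add: mat_diag_def)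
  have nz: "\<forall>i<n. d i \<noteq> 0" using one by fastforce
  then have e_eq: "e i = 1 / d i" if "i < n" for i
    using one[OF that] that by (simp add: eq_divide_eq mult.commute)
  have "N = mat n n (\<lambda>(i, j). d i * M $$ (i, j) / d j)"
    unfolding conj(2) d e mat_diag_conj[OF M] by (rule eq_matI) (simp_all add: e_eq)
  then show "\<exists>d. (\<forall>i<n. d i \<noteq> 0) \<and> N = mat n n (\<lambda>(i, j). d i * M $$ (i, j) / d j)" using nz by blast
qed

text \<open>This is the independence of eigenvectors for distinct eigenvalues, by induction on the
  number of nonzero coefficients.\<close>

lemma eigenvector_combination_zero:
  fixes A :: "'a::field mat"
  assumes A: "A \<in> carrier_mat n n" and a: "inj_on a {..<n}"
    and v: "\<And>i. i < n \<Longrightarrow> eigenvector A (v i) (a i)"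
    and "\<forall>s<n. (\<Sum>i<n. v i $ s * x i) = 0" and "k < n"
  shows "x k = 0"
  using assms(4,5)
proof (induction "card {i. i < n \<and> x i \<noteq> 0}" arbitrary: x k rule: less_induct)
  case (less x k)
  show ?case
  proof (rule ccontr)
    assume xk: "x k \<noteq> 0"
    \<comment> \<open>These are the coefficients after applying \<open>A\<close> minus
      \<open>a k\<close> times the identity to the relation: the one at \<open>k\<close>
      disappears.\<close>
    define y where "y i = (a i - a k) * x i" for i
    have carr: "v i \<in> carrier_vec n" and nz: "v i \<noteq> 0\<^sub>v n" and ev: "A *\<^sub>v v i = a i \<cdot>\<^sub>v v i" if "i < n" for i
      using v[OF that] A by (auto simp: eigenvector_def)
    have ent: "(\<Sum>r<n. A $$ (s, r) * v i $ r) = a i * v i $ s" if "i < n" "s < n" for i s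
      using arg_cong[OF ev[OF that(1)], of "\<lambda>w. w $ s"] that A carr[OF that(1)]
      by (simp add: scalar_prod_def lessThan_atLeast0)
    have "(\<Sum>i<n. v i $ s * y i) = 0" if s: "s < n" for s
    proof -
      have "(\<Sum>i<n. a i * v i $ s * x i) = (\<Sum>i<n. \<Sum>r<n. A $$ (s, r) * v i $ r * x i)"
        using ent s by (simp flip: sum_distrib_right)
      also have "\<dots> = (\<Sum>r<n. A $$ (s, r) * (\<Sum>i<n. v i $ r * x i))"
        by (subst sum.swap) (simp add: sum_distrib_left mult.assoc)
      also have "\<dots> = 0" using less.prems(1) by simp
      finally have "(\<Sum>i<n. a i * v i $ s * x i) = 0" .
      moreover have "(\<Sum>i<n. v i $ s * y i) =
        (\<Sum>i<n. a i * v i $ s * x i) - a k * (\<Sum>i<n. v i $ s * x i)"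
        by (simp add: y_def sum_distrib_left algebra_simps flip: sum_subtractf)
      ultimately show ?thesis using less.prems(1) s by simp
    qed
    moreover have "card {i. i < n \<and> y i \<noteq> 0} < card {i. i < n \<and> x i \<noteq> 0}"
      using less.prems(2) xk by (intro psubset_card_mono) (auto simp: y_def)
    \<comment> \<open>The shorter relation is trivial, so only the term at \<open>k\<close> remains
      in the original one, and \<open>v k\<close> would be zero.\<close>
    ultimately have "y i = 0" if "i < n" for i using less.hyps that by blast
    then have x0: "x i = 0" if "i < n" "i \<noteq> k" for i
      using that a less.prems(2) by (auto simp: y_def inj_on_def)
    have "v k $ s = 0" if "s < n" for s
    proof -
      have "(\<Sum>i<n. v i $ s * x i) = v k $ s * x k"
        using x0 less.prems(2) by (subst sum.remove[of _ k]) (auto intro!: sum.neutral)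
      then show ?thesis using less.prems(1) that xk by auto
    qed
    then have "v k = 0\<^sub>v n" using carr[OF less.prems(2)] by (intro eq_vecI) auto
    then show False using nz less.prems(2) by blast
  qed
qed

text \<open>The columns of \<open>Q\<close> are eigenvectors for the eigenvalues listed in
  increasing order; their independence makes \<open>Q\<close> invertible.\<close>

lemma diagonalization:
  fixes A :: "'a::{field, linorder} mat \<times> 'a mat"
  assumes "A \<in> D n"
  obtains a M where "strict_mono_on {..<n} a" "M \<in> carrier_mat n n" "(mat_diag n a, M) \<in> orbit n A"
proof -
  let ?K = "{k. eigenvalue (fst A) k}"
  have K: "finite ?K" "card ?K = n" and A: "fst A \<in> carrier_mat n n" "snd A \<in> carrier_mat n n"
    using assms by (auto simp: D_def)
  define a where "a i = sorted_list_of_set ?K ! i" for i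
  have len: "length (sorted_list_of_set ?K) = n" using K by simp
  have a: "strict_mono_on {..<n} a"
    unfolding a_def strict_mono_on_def
    using sorted_wrt_nth_less[OF strict_sorted_list_of_set] len by auto
  then have inj: "inj_on a {..<n}" by (rule strict_mono_on_imp_inj_on)
  have "eigenvalue (fst A) (a i)" if "i < n" for i
    using nth_mem[of i "sorted_list_of_set ?K"] len K that by (simp add: a_def)
  then obtain v where v: "\<And>i. i < n \<Longrightarrow> eigenvector (fst A) (v i) (a i)"
    unfolding eigenvalue_def by metis
  have carr: "v i \<in> carrier_vec n" and ev: "fst A *\<^sub>v v i = a i \<cdot>\<^sub>v v i" if "i < n" for i
    using v[OF that] A by (auto simp: eigenvector_def)
  define Q where "Q = mat n n (\<lambda>(s, i). v i $ s)"
  have Q: "Q \<in> carrier_mat n n" by (simp add: Q_def)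
  have "det Q \<noteq> 0"
  proof
    \<comment> \<open>A nonzero kernel vector of \<open>Q\<close> would be a nontrivial relation
      among the eigenvectors.\<close>
    assume "det Q = 0"
    then obtain x where x: "x \<in> carrier_vec n" "x \<noteq> 0\<^sub>v n" "Q *\<^sub>v x = 0\<^sub>v n"
      using det_0_iff_vec_prod_zero_field[OF Q] by blast
    have "(\<Sum>i<n. v i $ s * x $ i) = 0" if "s < n" for s
      using arg_cong[OF x(3), of "\<lambda>w. w $ s"] that x(1)
      by (simp add: Q_def scalar_prod_def lessThan_atLeast0)
    then have "x $ i = 0" if "i < n" for i
      using eigenvector_combination_zero[OF A(1) inj v, of "\<lambda>i. x $ i" i] that by blast
    then show False using x by (auto intro!: eq_vecI)
  qed
  from det_non_zero_imp_unit[OF Q this, unfolded Units_def, of "()"]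
  obtain P where P: "P \<in> carrier_mat n n" "P * Q = 1\<^sub>m n" "Q * P = 1\<^sub>m n"
    by (auto simp: ring_mat_def)
  have "fst A * Q = Q * mat_diag n a"
  proof (rule eq_matI)
    fix s i assume "s < dim_row (Q * mat_diag n a)" "i < dim_col (Q * mat_diag n a)"
    then have si: "s < n" "i < n" using Q by (auto simp: mat_diag_def)
    have "col Q i = v i" using si carr[OF si(2)] by (intro eq_vecI) (auto simp: Q_def)
    then have "(fst A * Q) $$ (s, i) = (fst A *\<^sub>v v i) $ s" using si A Q by simp
    also have "\<dots> = v i $ s * a i" using ev[OF si(2)] si carr[OF si(2)] by simp
    finally show "(fst A * Q) $$ (s, i) = (Q * mat_diag n a) $$ (s, i)"
      using si by (simp add: mat_diag_mult_right[OF Q]) (simp add: Q_def)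
  qed (use A Q in \<open>auto simp: mat_diag_def\<close>)
  then have "P * fst A * Q = mat_diag n a"
    using A P Q assoc_mult_mat[OF P(1) A(1) Q] assoc_mult_mat[OF P(1) Q mat_diag_dim, of a, symmetric]
    by (simp add: left_mult_one_mat[OF mat_diag_dim])
  then have "(mat_diag n a, P * snd A * Q) \<in> orbit n A"
    using orbitI[OF P(1) Q P(2,3), of A] by simp
  moreover have "P * snd A * Q \<in> carrier_mat n n" using P A Q by simp
  ultimately show thesis using that[OF a] by blast
qed

section \<open>Existence and uniqueness of the canonical pair in an orbit\<close>

lemma canonical_pair_iff:
  fixes C :: "'a::{field, linorder} mat \<times> 'a mat"
  shows "canonical_pair n C \<longleftrightarrow> C \<in> D n \<and>
    (\<exists>a. fst C = mat_diag n a \<and> strict_mono_on {..<n} a) \<and>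
    (\<forall>(i, j) \<in> kruskal (support n (snd C)). snd C $$ (i, j) = 1)"
proof -
  have mono: "(\<forall>i j. i < j \<and> j < n \<longrightarrow> a i < a j) \<longleftrightarrow> strict_mono_on {..<n} a" for a :: "nat \<Rightarrow> 'a"
    by (auto simp: strict_mono_on_def)
  have carrier: "snd C \<in> carrier_mat n n" if "C \<in> D n"
    using D_pairs[OF that] by (auto simp: pairs_def)
  show ?thesis
    unfolding canonical_pair_def mono
    by (intro conj_cong refl) (rule canonical_star_mat_iff[OF carrier])
qed

lemma support_scaled:
  fixes M :: "'a::field mat"
  assumes "\<forall>i<n. d i \<noteq> 0"
  shows "support n (mat n n (\<lambda>(i, j). d i * M $$ (i, j) / d j)) = support n M"
  using assms by (auto simp: support_def)

lemma reach_kruskal: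
  assumes e: "e \<in> P" shows "e \<in> reach (kruskal P)"
proof -
  have "reach (below (kruskal P) e) \<subseteq> reach (kruskal P)"
    by (rule reach_mono) (auto simp: below_def)
  then have "reach (below P e) \<subseteq> reach (kruskal P)" unfolding reach_below_kruskal .
  then show ?thesis using e reach_edge[of e "kruskal P"] by (auto simp: kruskal_def)
qed

lemma ex_canonical_pair:
  fixes A :: "'a::{field, linorder} mat \<times> 'a mat"
  assumes "A \<in> D n" shows "\<exists>C. C \<in> orbit n A \<and> canonical_pair n C"
proof -
  obtain a M where a: "strict_mono_on {..<n} a" and M: "M \<in> carrier_mat n n"
    and orb: "(mat_diag n a, M) \<in> orbit n A" using diagonalization[OF assms] .
  let ?G = "kruskal (support n M)"
  have sub: "?G \<subseteq> support n M" by (rule kruskal_subset)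
  have "finite ?G" by (rule finite_subset[OF subset_trans[OF sub support_subset]]) simp
  moreover have "(case e of (i, j) \<Rightarrow> M $$ (i, j)) \<noteq> 0" if "e \<in> ?G" for e
    using that sub by (auto simp: support_def)
  \<comment> \<open>Every forest arrow is a bridge, so the scaling exists; conjugation by the
    diagonal matrix of \<open>t\<close> turns each forest entry into
    \<open>t i * M $$ (i, j) / t j\<close>, which is 1.\<close>
  ultimately obtain t where t: "\<forall>i. t i \<noteq> 0" "\<forall>(i, j) \<in> ?G. t i * M $$ (i, j) = t j"
    using ex_scaling[of ?G "\<lambda>(i, j). M $$ (i, j)"] kruskal_bridge by auto
  define N where "N = mat n n (\<lambda>(i, j). t i * M $$ (i, j) / t j)"
  define C where "C = (mat_diag n a, N)"
  let ?g = "mat_diag n t" and ?h = "mat_diag n (\<lambda>i. inverse (t i))"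
  have gh: "?g * ?h = 1\<^sub>m n" "?h * ?g = 1\<^sub>m n" using t(1) by simp_all
  have scale: "t i * a i * inverse (t i) = a i" for i using t(1) by (simp add: field_simps)
  have "?g * mat_diag n a * ?h = mat_diag n a" by (simp only: mat_diag_diag scale)
  moreover have "?g * M * ?h = N" unfolding mat_diag_conj[OF M] by (simp add: N_def divide_inverse)
  ultimately have "C \<in> orbit n (mat_diag n a, M)"
    using orbitI[OF _ _ gh, of "(mat_diag n a, M)"] by (simp add: C_def)
  then have C: "C \<in> orbit n A" using orbit_trans[OF D_pairs[OF assms] orb] by blast
  \<comment> \<open>Scaling does not move the forest, so the normalised entries are those that
    canonicity concerns.\<close>
  have supp: "support n N = support n M" using support_scaled t(1) by (auto simp: N_def)
  have "N $$ (i, j) = 1" if "(i, j) \<in> ?G" for i j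
  proof -
    have "i < n" "j < n" using that sub by (auto simp: support_def)
    then show ?thesis using t that by (auto simp: N_def)
  qed
  then have "canonical_pair n C"
    unfolding canonical_pair_iff using a orbit_D[OF assms C] by (auto simp: C_def supp)
  then show ?thesis using C by blast
qed

text \<open>Both pairs have entry 1 on the common forest, so the conjugating diagonal is constant on
  its components. A nonzero off-diagonal entry joins vertices of one component and is therefore
  unchanged.\<close>

lemma canonical_pair_unique:
  fixes C C' :: "'a::{field, linorder} mat \<times> 'a mat"
  assumes C: "canonical_pair n C" and C': "canonical_pair n C'" and orb: "C' \<in> orbit n C"
  shows "C' = C"
proof -
  obtain a M where a: "C = (mat_diag n a, M)" "strict_mono_on {..<n} a"
    using C by (cases C) (auto simp: canonical_pair_iff)
  obtain b N where b: "C' = (mat_diag n b, N)" "strict_mono_on {..<n} b"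
    using C' by (cases C') (auto simp: canonical_pair_iff)
  have M: "M \<in> carrier_mat n n" using C a D_pairs by (auto simp: canonical_pair_iff pairs_def)
  note od = orbit_diagonal[OF M orb[unfolded a(1) b(1)] a(2) b(2)]
  obtain d where d: "\<forall>i<n. d i \<noteq> 0" "N = mat n n (\<lambda>(i, j). d i * M $$ (i, j) / d j)"
    using od(2) by blast
  have supp: "support n N = support n M" using d support_scaled by blast
  let ?G = "kruskal (support n M)"
  have edge: "d i = d j" if "(i, j) \<in> ?G" for i j
  proof -
    have ij: "i < n" "j < n" using that kruskal_subset by (auto simp: support_def)
    have "M $$ (i, j) = 1" "N $$ (i, j) = 1"
      using C C' that by (auto simp: canonical_pair_iff a(1) b(1) supp)
    then show ?thesis using d ij by auto
  qed
  have const: "d i = d j" if "(i, j) \<in> reach ?G" for i j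
    using that unfolding reach_def by (induction rule: rtrancl_induct) (use edge in force)+
  have "N $$ (i, j) = M $$ (i, j)" if ij: "i < n" "j < n" for i j
  proof (cases "i = j \<or> M $$ (i, j) = 0")
    case False
    then have "(i, j) \<in> support n M" using ij by (simp add: support_def)
    then have "d i = d j" using reach_kruskal const by blast
    then show ?thesis using d ij by auto
  qed (use d ij in auto)
  then have "N = M" using M d(2) by (intro eq_matI) auto
  moreover have "mat_diag n b = mat_diag n a" using od(1) by (auto simp: mat_diag_def)
  ultimately show ?thesis by (simp add: a(1) b(1))
qed

text \<open>Any diagonalised representative can replace the canonical one, because the two differ by
  diagonal conjugation and have the same support.\<close>

lemma type_of_diagonal:
  fixes A :: "'a::{field, linorder} mat \<times> 'a mat"
  assumes "A \<in> D n" "strict_mono_on {..<n} a" "M \<in> carrier_mat n n" "(mat_diag n a, M) \<in> orbit n A"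
  shows "type_of n A = kruskal (support n M)"
proof -
  note A = D_pairs[OF assms(1)]
  obtain C where C: "C \<in> orbit n A" "canonical_pair n C" using ex_canonical_pair[OF assms(1)] by blast
  have "(THE C. C \<in> orbit n A \<and> canonical_pair n C) = C"
  proof (rule the_equality)
    fix C' assume C': "C' \<in> orbit n A \<and> canonical_pair n C'"
    then have "C' \<in> orbit n C"
      using orbit_trans[OF orbit_pairs[OF A C(1)] orbit_sym[OF A C(1)], of C'] by simp
    then show "C' = C" using canonical_pair_unique[OF C(2), of C'] C' by simp
  qed (use C in blast)
  then have type: "type_of n A = kruskal (support n (snd C))"
    using type_of_canonical_eq[OF C(2)] by (simp add: type_of_def)
  obtain b N where b: "C = (mat_diag n b, N)" "strict_mono_on {..<n} b"
    using C(2) by (cases C) (auto simp: canonical_pair_iff)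
  have "(mat_diag n b, N) \<in> orbit n (mat_diag n a, M)"
    unfolding b(1)[symmetric]
    using orbit_trans[OF orbit_pairs[OF A assms(4)] orbit_sym[OF A assms(4)] C(1)] .
  from orbit_diagonal(2)[OF assms(3) this assms(2) b(2)] have "support n N = support n M"
    using support_scaled[of n _ M] by blast
  then show ?thesis using type b(1) by simp
qed

text \<open>Up to sign the \<open>sigma\<close> values are the coefficients below degree
  \<open>n\<close>; the polynomials are monic of degree \<open>n\<close>.\<close>

lemma char_poly_eq_if_sigma_eq:
  assumes "\<forall>f \<in> Set_sigma n. f A = f B" and "A \<in> pairs n" "B \<in> pairs n"
  shows "char_poly (fst A) = char_poly (fst B)"
proof (rule poly_eqI)
  fix m
  have A: "fst A \<in> carrier_mat n n" "fst B \<in> carrier_mat n n" using assms(2,3) by (auto simp: pairs_def)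
  note deg = degree_monic_char_poly[OF A(1)] degree_monic_char_poly[OF A(2)]
  consider "m < n" | "m = n" | "m > n" by linarith
  then show "coeff (char_poly (fst A)) m = coeff (char_poly (fst B)) m"
  proof cases
    case 1
    then have mem: "(\<lambda>A. sigma n (n - m) (fst A)) \<in> Set_sigma n" by (auto simp: Set_sigma_def)
    have "sigma n (n - m) (fst A) = sigma n (n - m) (fst B)" using bspec[OF assms(1) mem] .
    then show ?thesis using 1 by (simp add: sigma_def) (metis left_minus_one_mult_self mult.left_commute)
  qed (use deg in \<open>auto simp: coeff_eq_0\<close>)
qed

theorem theorem4p3:
  fixes n :: nat and A B :: "'a::{field, linorder} mat \<times> 'a mat"
  assumes "n \<ge> 2"
    and "\<exists>K :: 'a set. finite K \<and> card K = n"
    and "A \<in> D n" and "B \<in> D n"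
    and "\<forall>f \<in> Set_sigma n \<union> Set_zeta n. f A = f B"
  shows "type_of n A = type_of n B"
proof -
  have sigma: "\<forall>f \<in> Set_sigma n. f A = f B" and zeta: "\<forall>f \<in> Set_zeta n. f A = f B"
    using assms(5) by blast+
  have A: "A \<in> pairs n" and B: "B \<in> pairs n" using assms(3,4) D_pairs by blast+
  obtain a M where a: "strict_mono_on {..<n} a" and M: "M \<in> carrier_mat n n"
    and orbA: "(mat_diag n a, M) \<in> orbit n A" using diagonalization[OF assms(3)] .
  obtain b N where b: "strict_mono_on {..<n} b" and N: "N \<in> carrier_mat n n"
    and orbB: "(mat_diag n b, N) \<in> orbit n B" using diagonalization[OF assms(4)] .
  have "a ` {..<n} = b ` {..<n}"
    using eigenvalues_char_poly[OF orbit_pairs[OF A orbA]] eigenvalues_char_poly[OF orbit_pairs[OF B orbB]]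
      orbit_char_poly[OF A orbA] orbit_char_poly[OF B orbB] char_poly_eq_if_sigma_eq[OF sigma A B]
    by (simp add: eigenvalues_mat_diag)
  \<comment> \<open>With one common diagonal, the same test polynomials apply to both
    representatives.\<close>
  then have "mat_diag n b = mat_diag n a"
    using strict_mono_on_image_eq[OF a b] by (auto simp: mat_diag_def)
  then have orbB': "(mat_diag n a, N) \<in> orbit n B" using orbB by simp
  have inj: "inj_on a {..<n}" using a by (rule strict_mono_on_imp_inj_on)
  have nc: "nc_eval n f A = 0\<^sub>m n n \<longleftrightarrow> nc_eval n f (mat_diag n a, M) = 0\<^sub>m n n"
    "nc_eval n f B = 0\<^sub>m n n \<longleftrightarrow> nc_eval n f (mat_diag n a, N) = 0\<^sub>m n n" for f
    using nc_eval_orbit orbA orbB' A B orbit_pairs orbit_sym by blast+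
  \<comment> \<open>Vanishing of the test polynomial for \<open>(i, j)\<close> passes from one
    representative to \<open>A\<close>, by \<open>zeta\<close> to \<open>B\<close>, and on to the
    other representative.\<close>
  have "M $$ (i, j) = 0 \<longleftrightarrow> N $$ (i, j) = 0" if "i < n" "j < n" for i j
    using nc_eval_eq_if_zeta_eq[OF zeta A B nc_degree_root_poly[OF that, of a]]
      nc_eval_root_poly[OF M inj that] nc_eval_root_poly[OF N inj that] nc by blast
  then have "support n M = support n N" by (auto simp: support_def)
  then show ?thesis
    using type_of_diagonal[OF assms(3) a M orbA] type_of_diagonal[OF assms(4) a N orbB'] by simp
qed

end
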